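(* Let $G$ be a plane graph that is facially complete. Then $G$ belongs to one of the seven types of the FC catalog.
   Context: All graphs are finite and simple. A plane graph is a graph with a fixed crossing-free drawing in the plane. Two plane graphs are regarded as the same if one is carried to the other by a homeomorphism of the sphere, so the choice of unbounded face is immaterial and reflections are allowed. The facial closure $\overline{G}$ of a plane graph $G$ is obtained by adding an edge $uv$ whenever $u,v$ are distinct, nonadjacent, and lie together on the boundary of some face of $G$. $G$ is facially complete if $\overline{G}$ is a complete graph. A plane graph is called outerplanar if some single face has all of its vertices on its boundary. The n-wheel ($n\ge 4$) consists of a cycle (the rim) on $n-1$ vertices together with a center vertex drawn inside the rim and joined to every rim vertex by an edge (a radius); the 4-wheel is $K_4$. $\kappa$ denotes vertex connectivity. The FC catalog consists of the following seven types of plane graphs. Type 1: Start from the 3-prism: two disjoint triangles $x_1x_2x_3$ and $y_1y_2y_3$ plus the edges $x_iy_i$, drawn with one triangle inside the other. Replace each edge $x_iy_i$ by a path with $a_i\ge 0$ internal vertices. Type 2: Start from $K_4$ drawn with a vertex $c$ inside the triangle $t_1t_2t_3$. Replace each edge $ct_i$ by a path with $a_i\ge 1$ internal vertices. Type 3: Two vertices $\alpha_0,\alpha_1$ joined by three internally disjoint paths, each having at least two internal vertices. Type 4: An $n$-wheel with $n\ge 4$ from which some (possibly no) radii are deleted, such that the resulting plane graph is not outerplanar. Type 5: A cycle together with a (possibly empty) set of pairwise noncrossing chords, all drawn on the same side of the cycle. Type 6: $K_1$, or a connected outerplanar plane graph with $\kappa=1$; this includes $K_2$ and graphs with a cut vertex.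 Type 7: A disconnected outerplanar plane graph. *)

theory Defs
  imports "HOL-Analysis.Analysis"
begin

definition plane_graph ::
  "'v set \<Rightarrow> 'v set set \<Rightarrow> ('v \<Rightarrow> complex) \<Rightarrow> ('v set \<Rightarrow> real \<Rightarrow> complex) \<Rightarrow> bool" where
  "plane_graph V E pos gam \<longleftrightarrow>
     finite V \<and>
     (\<forall>e\<in>E. e \<subseteq> V \<and> card e = 2) \<and>
     inj_on pos V \<and>
     (\<forall>e\<in>E. arc (gam e) \<and> {pathstart (gam e), pathfinish (gam e)} = pos ` e) \<and>
     (\<forall>e\<in>E. \<forall>v\<in>V. pos v \<in> path_image (gam e) \<longrightarrow> v \<in> e) \<and>
     (\<forall>e\<in>E. \<forall>e'\<in>E. e \<noteq> e' \<longrightarrow>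
        path_image (gam e) \<inter> path_image (gam e') \<subseteq> pos ` (e \<inter> e'))"

definition drawing ::
  "'v set \<Rightarrow> 'v set set \<Rightarrow> ('v \<Rightarrow> complex) \<Rightarrow> ('v set \<Rightarrow> real \<Rightarrow> complex) \<Rightarrow> complex set" where
  "drawing V E pos gam = pos ` V \<union> (\<Union>e\<in>E. path_image (gam e))"

definition faces ::
  "'v set \<Rightarrow> 'v set set \<Rightarrow> ('v \<Rightarrow> complex) \<Rightarrow> ('v set \<Rightarrow> real \<Rightarrow> complex) \<Rightarrow> complex set set" where
  "faces V E pos gam = components (- drawing V E pos gam)"

definition on_face_boundary ::
  "('v \<Rightarrow> complex) \<Rightarrow> 'v \<Rightarrow> complex set \<Rightarrow> bool" where
  "on_face_boundary pos v F \<longleftrightarrow> pos v \<in> frontier F"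

definition facial_closure_edges ::
  "'v set \<Rightarrow> 'v set set \<Rightarrow> ('v \<Rightarrow> complex) \<Rightarrow> ('v set \<Rightarrow> real \<Rightarrow> complex) \<Rightarrow> 'v set set" where
  "facial_closure_edges V E pos gam = E \<union>
     {{u, v} | u v. u \<in> V \<and> v \<in> V \<and> u \<noteq> v \<and> {u, v} \<notin> E \<and>
        (\<exists>F\<in>faces V E pos gam. on_face_boundary pos u F \<and> on_face_boundary pos v F)}"

definition facially_complete ::
  "'v set \<Rightarrow> 'v set set \<Rightarrow> ('v \<Rightarrow> complex) \<Rightarrow> ('v set \<Rightarrow> real \<Rightarrow> complex) \<Rightarrow> bool" where
  "facially_complete V E pos gam \<longleftrightarrow>
     (\<forall>u\<in>V. \<forall>v\<in>V. u \<noteq> v \<longrightarrow> {u, v} \<in> facial_closure_edges V E pos gam)"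

definition outerplanar_plane ::
  "'v set \<Rightarrow> 'v set set \<Rightarrow> ('v \<Rightarrow> complex) \<Rightarrow> ('v set \<Rightarrow> real \<Rightarrow> complex) \<Rightarrow> bool" where
  "outerplanar_plane V E pos gam \<longleftrightarrow>
     (\<exists>F\<in>faces V E pos gam. \<forall>v\<in>V. on_face_boundary pos v F)"

definition graph_connected :: "'v set \<Rightarrow> 'v set set \<Rightarrow> bool" where
  "graph_connected V E \<longleftrightarrow> V \<noteq> {} \<and>
     (\<forall>u\<in>V. \<forall>v\<in>V. (\<lambda>a b. {a, b} \<in> E \<and> a \<in> V \<and> b \<in> V)\<^sup>*\<^sup>* u v)"

definition vertex_connectivity :: "'v set \<Rightarrow> 'v set set \<Rightarrow> nat" where
  "vertex_connectivity V E = (LEAST k. \<exists>S\<subseteq>V. card S = k \<and>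
      (\<not> graph_connected (V - S) {e\<in>E. e \<inter> S = {}} \<or> card (V - S) \<le> 1))"

definition path_edges :: "'v list \<Rightarrow> 'v set set" where
  "path_edges xs = (\<lambda>(a, b). {a, b}) ` set (zip xs (tl xs))"

definition cycle_edges :: "'v list \<Rightarrow> 'v set set" where
  "cycle_edges xs = path_edges (xs @ [hd xs])"

text \<open>Type 1: subdivided 3-prism. P i is the path from x_i to y_i
(a_i = length (P i) - 2 internal vertices).\<close>

definition fc_type1 :: "'v set \<Rightarrow> 'v set set \<Rightarrow> bool" where
  "fc_type1 V E \<longleftrightarrow> (\<exists>P1 P2 P3.
     length P1 \<ge> 2 \<and> length P2 \<ge> 2 \<and> length P3 \<ge> 2 \<and>
     distinct (P1 @ P2 @ P3) \<and> V = set (P1 @ P2 @ P3) \<and>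
     E = path_edges P1 \<union> path_edges P2 \<union> path_edges P3 \<union>
         {{hd P1, hd P2}, {hd P2, hd P3}, {hd P3, hd P1}} \<union>
         {{last P1, last P2}, {last P2, last P3}, {last P3, last P1}})"

text \<open>Type 2: K4 with centre c and triangle t1 t2 t3, edge c t_i subdivided by
a_i \<ge> 1 internal vertices; c # Q i is the path from c to t_i.\<close>

definition fc_type2 :: "'v set \<Rightarrow> 'v set set \<Rightarrow> bool" where
  "fc_type2 V E \<longleftrightarrow> (\<exists>c Q1 Q2 Q3.
     length Q1 \<ge> 2 \<and> length Q2 \<ge> 2 \<and> length Q3 \<ge> 2 \<and>
     distinct (c # Q1 @ Q2 @ Q3) \<and> V = set (c # Q1 @ Q2 @ Q3) \<and>
     E = path_edges (c # Q1) \<union> path_edges (c # Q2) \<union> path_edges (c # Q3) \<union>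
         {{last Q1, last Q2}, {last Q2, last Q3}, {last Q3, last Q1}})"

text \<open>Type 3: theta graph, three internally disjoint a0-a1 paths with internal
vertex lists Q i, each of length at least 2.\<close>

definition fc_type3 :: "'v set \<Rightarrow> 'v set set \<Rightarrow> bool" where
  "fc_type3 V E \<longleftrightarrow> (\<exists>a0 a1 Q1 Q2 Q3.
     length Q1 \<ge> 2 \<and> length Q2 \<ge> 2 \<and> length Q3 \<ge> 2 \<and>
     distinct (a0 # a1 # Q1 @ Q2 @ Q3) \<and> V = set (a0 # a1 # Q1 @ Q2 @ Q3) \<and>
     E = path_edges (a0 # Q1 @ [a1]) \<union> path_edges (a0 # Q2 @ [a1]) \<union>
         path_edges (a0 # Q3 @ [a1]))"

text \<open>Type 4: n-wheel (n \<ge> 4, rim R with n - 1 \<ge> 3 vertices, centre c) with some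
radii deleted (the radii kept go to the rim vertices in S), such that the plane
graph is not outerplanar.\<close>

definition fc_type4 ::
  "'v set \<Rightarrow> 'v set set \<Rightarrow> ('v \<Rightarrow> complex) \<Rightarrow> ('v set \<Rightarrow> real \<Rightarrow> complex) \<Rightarrow> bool" where
  "fc_type4 V E pos gam \<longleftrightarrow>
     (\<exists>c R S. length R \<ge> 3 \<and> distinct (c # R) \<and> V = set (c # R) \<and> S \<subseteq> set R \<and>
        E = cycle_edges R \<union> {{c, r} | r. r \<in> S}) \<and>
     \<not> outerplanar_plane V E pos gam"

text \<open>Type 5: a spanning cycle C plus chords, all chords drawn on the same side
of C (their interiors lie in one component of the complement of the drawn cycle).
Noncrossing is automatic in a plane graph.\<close>

definition fc_type5 ::
  "'v set \<Rightarrow> 'v set set \<Rightarrow> ('v \<Rightarrow> complex) \<Rightarrow> ('v set \<Rightarrow> real \<Rightarrow> complex) \<Rightarrow> bool" where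
  "fc_type5 V E pos gam \<longleftrightarrow>
     (\<exists>C. length C \<ge> 3 \<and> distinct C \<and> V = set C \<and> cycle_edges C \<subseteq> E \<and>
        (\<exists>S\<in>components (- (\<Union>e\<in>cycle_edges C. path_image (gam e))).
           \<forall>e\<in>E - cycle_edges C. path_image (gam e) - pos ` e \<subseteq> S))"

definition fc_type6 ::
  "'v set \<Rightarrow> 'v set set \<Rightarrow> ('v \<Rightarrow> complex) \<Rightarrow> ('v set \<Rightarrow> real \<Rightarrow> complex) \<Rightarrow> bool" where
  "fc_type6 V E pos gam \<longleftrightarrow>
     card V = 1 \<or>
     (graph_connected V E \<and> outerplanar_plane V E pos gam \<and> vertex_connectivity V E = 1)"

definition fc_type7 ::
  "'v set \<Rightarrow> 'v set set \<Rightarrow> ('v \<Rightarrow> complex) \<Rightarrow> ('v set \<Rightarrow> real \<Rightarrow> complex) \<Rightarrow> bool" where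
  "fc_type7 V E pos gam \<longleftrightarrow>
     \<not> graph_connected V E \<and> outerplanar_plane V E pos gam"

end

(* Call theta a subdivision of K_{2,3}. Jordan's and Janiszewski's theorems show that no connected set
   off a theta has points of all three open paths in its closure. If G is facially complete, any two
   vertices are linked by such a connected set (a face or an open edge), so every theta in G spans G
   and its branch vertices are nonadjacent. When a theta exists, these two facts alone determine G:
   rerouting the theta along any further edge must again give a spanning theta, which leaves only
   types 1 to 4.

   Otherwise take a longest cycle Z. A path leaving and re-entering Z would give a theta or a longer
   cycle, so each component of G - Z has at most one neighbour on Z. If Z does not span, a face common to
   a vertex off Z and a vertex of Z not attached to it carries all vertices, because any vertex
   missing from a face is separated from it by a cycle of G that contains all vertices of the face.
   If Z spans, two chords on different sides of Z either do not cross, and then cut off two vertices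
   without a link, or they cross, and then G = K_4. *)

theory Submission
  imports Defs
begin

section \<open>Regions of theta curves\<close>

text \<open>Edges are arbitrary arcs, so nothing is known about the order in which they leave a
  vertex. Topology therefore enters only through connected sets glued together at points of their
  closures (a vertex with its links, a side of a Jordan curve) and through Janiszewski's theorem: if
  neither of two sets separates two points and the sets meet in a connected set, their union does
  not separate the points either. In every use the intersection is an arc or a single point. A link
  may be an open edge because facial completeness says nothing directly about faces at adjacent
  vertices; all that matters is that a link avoids a given curve of the graph, and an open edge does
  so unless it is part of that curve. Nonadjacency of the branch vertices does not follow from
  spanning, since an edge between them adds no vertex. It ensures that a path shortened along an
  edge keeps an internal vertex, so that the rerouted theta is again a theta. K_4 contains no theta,
  which is why a graph of type 4 still appears among the theta-free ones.\<close>

lemma connected_insert_closure: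
  assumes "connected X" "p \<in> closure X"
  shows "connected (insert p X)"
  using connected_intermediate_closure[OF assms(1), of "insert p X"] assms(2) closure_subset by blast

text \<open>A connected set that contains \<open>F\<close> and leaves it crosses the frontier. So
  whatever lies off the frontier of \<open>F\<close> can be taken out of \<open>K\<close> without
  enlarging \<open>F\<close>; in this way a region of a large drawing becomes a region of a smaller
  one.\<close>

lemma component_of_bigger_complement:
  fixes K :: "complex set"
  assumes "F \<in> components (- K)" "K' \<subseteq> K" "frontier F \<subseteq> K'"
  shows "F \<in> components (- K')"
proof -
  have F: "F \<noteq> {}" "F \<subseteq> - K" "connected F"
    using in_components_nonempty[OF assms(1)] in_components_connected[OF assms(1)]
      in_components_subset[OF assms(1)] by simp_all
  have max: "D = F" if D: "D \<noteq> {}" "F \<subseteq> D" "D \<subseteq> - K'" "connected D" for D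
  proof (rule ccontr)
    assume "D \<noteq> F"
    then have 1: "D - F \<noteq> {}" "D \<inter> F \<noteq> {}" using D F by auto
    have "D \<inter> frontier F \<noteq> {}" by (rule connected_Int_frontier[OF D(4) 1(2) 1(1)])
    then show False using assms(3) D(3) by blast
  qed
  show ?thesis unfolding in_components_maximal
    using F max assms(2) by (intro conjI allI impI) auto
qed

lemma frontier_component_closed:
  fixes K :: "complex set"
  assumes "closed K" "F \<in> components (- K)"
  shows "frontier F \<subseteq> K"
  using frontier_of_components_closed_complement[OF assms] by blast

section \<open>Jordan curves made of two arcs\<close>

locale two_arcs =
  fixes c1 c2 :: "real \<Rightarrow> complex" and a b :: complex
  assumes arcs: "arc c1" "arc c2"
    and ends: "pathstart c1 = a" "pathfinish c1 = b" "pathstart c2 = a" "pathfinish c2 = b"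
    and meet: "path_image c1 \<inter> path_image c2 = {a, b}"
begin

abbreviation J where "J \<equiv> path_image c1 \<union> path_image c2"

lemma jordan:
  "components (- J) = {inside J, outside J}" "frontier (inside J) = J" "frontier (outside J) = J"
  "inside J \<inter> outside J = {}"
proof -
  let ?c = "c1 +++ reversepath c2"
  have "simple_path ?c"
    by (rule simple_path_join_loop) (use arcs ends meet in \<open>auto simp: arc_reversepath\<close>)
  moreover have "pathfinish ?c = pathstart ?c" using ends by simp
  moreover have "path_image ?c = J" using ends by (simp add: path_image_join)
  ultimately have j: "inside J \<noteq> {}" "open (inside J)" "connected (inside J)"
    "outside J \<noteq> {}" "open (outside J)" "connected (outside J)" "inside J \<inter> outside J = {}"
    "inside J \<union> outside J = - J" "frontier (inside J) = J" "frontier (outside J) = J"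
    using Jordan_inside_outside[of ?c] by simp_all
  then show "frontier (inside J) = J" "frontier (outside J) = J" "inside J \<inter> outside J = {}"
    by auto
  have "inside J \<in> components (- J)"
    unfolding in_components_maximal
  proof (intro conjI allI impI)
    fix D assume D: "D \<noteq> {} \<and> inside J \<subseteq> D \<and> D \<subseteq> - J \<and> connected D"
    show "D = inside J"
    proof (rule ccontr)
      assume "D \<noteq> inside J"
      then have "D \<inter> frontier (inside J) \<noteq> {}"
        using connected_Int_frontier[of D "inside J"] D j(1) by blast
      then show False using D j(9) by blast
    qed
  qed (use j(1-6) j(8) in blast)+
  moreover have "outside J \<in> components (- J)"
    unfolding in_components_maximal
  proof (intro conjI allI impI)
    fix D assume D: "D \<noteq> {} \<and> outside J \<subseteq> D \<and> D \<subseteq> - J \<and> connected D"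
    show "D = outside J"
    proof (rule ccontr)
      assume "D \<noteq> outside J"
      then have "D \<inter> frontier (outside J) \<noteq> {}"
        using connected_Int_frontier[of D "outside J"] D j(4) by blast
      then show False using D j(10) by blast
    qed
  qed (use j(1-6) j(8) in blast)+
  moreover have "C = inside J \<or> C = outside J" if C: "C \<in> components (- J)" for C
  proof -
    have "C \<noteq> {}" "C \<subseteq> inside J \<union> outside J"
      using in_components_nonempty[OF C] in_components_subset[OF C] j(8) by simp_all
    then consider "C \<inter> inside J \<noteq> {}" | "C \<inter> outside J \<noteq> {}" by blast
    then show ?thesis
      using C calculation components_eq[of C "- J"] by cases auto
  qed
  ultimately show "components (- J) = {inside J, outside J}" by blast
qed

lemma component_frontier: "C \<in> components (- J) \<Longrightarrow> frontier C = J"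
  using jordan by auto

text \<open>A connected set off the curve lies on one side. The other side is free of it and can
  still be glued to the curve at any point, since the whole curve is its frontier.\<close>

lemma obtain_side_avoiding:
  assumes "connected Y" "Y \<inter> J = {}"
  obtains D where "D \<in> components (- J)" "D \<inter> Y = {}"
proof (cases "inside J \<inter> Y = {}")
  case True
  then show ?thesis using that jordan by blast
next
  case False
  then have "Y \<subseteq> inside J"
    using components_maximal[of "inside J" "- J" Y] assms jordan(1) by blast
  then show ?thesis using that[of "outside J"] jordan by blast
qed

lemma three_components:
  assumes "A \<in> components (- J)" "B \<in> components (- J)" "C \<in> components (- J)" "A \<noteq> B"
  shows "C = A \<or> C = B"
  using assms jordan(1) by auto

end

section \<open>Theta curves and Janiszewski's theorem\<close>

locale three_arcs =
  fixes c1 c2 c3 :: "real \<Rightarrow> complex" and a b :: complex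
  assumes arcs: "arc c1" "arc c2" "arc c3"
    and ends: "pathstart c1 = a" "pathfinish c1 = b" "pathstart c2 = a" "pathfinish c2 = b"
      "pathstart c3 = a" "pathfinish c3 = b"
    and meet: "path_image c1 \<inter> path_image c2 = {a, b}" "path_image c1 \<inter> path_image c3 = {a, b}"
      "path_image c2 \<inter> path_image c3 = {a, b}"
begin

abbreviation \<Theta> where "\<Theta> \<equiv> path_image c1 \<union> path_image c2 \<union> path_image c3"

lemma meetD:
  "x \<in> path_image c1 \<Longrightarrow> x \<in> path_image c2 \<Longrightarrow> x = a \<or> x = b"
  "x \<in> path_image c1 \<Longrightarrow> x \<in> path_image c3 \<Longrightarrow> x = a \<or> x = b"
  "x \<in> path_image c2 \<Longrightarrow> x \<in> path_image c3 \<Longrightarrow> x = a \<or> x = b"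
  using equalityD1[OF meet(1)] equalityD1[OF meet(2)] equalityD1[OF meet(3)] by auto

lemma ends_in:
  "a \<in> path_image c1" "b \<in> path_image c1" "a \<in> path_image c2" "b \<in> path_image c2"
  "a \<in> path_image c3" "b \<in> path_image c3"
  using ends by (metis pathstart_in_path_image pathfinish_in_path_image)+

lemma closed_theta: "closed \<Theta>"
  using arcs by (simp add: closed_Un closed_arc_image)

text \<open>Let \<open>D\<close> be a side of the curve of \<open>c1\<close> and \<open>c2\<close>
  that misses \<open>c3\<close>. The set \<open>X\<close> reaches \<open>D\<close> through
  \<open>p2\<close> without touching \<open>c1\<close> or \<open>c3\<close>, and through
  \<open>p1\<close> without touching \<open>c2\<close> or \<open>c3\<close>. These two obstacles
  meet in the arc \<open>c3\<close>, so by Janiszewski's theorem \<open>X\<close> reaches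
  \<open>D\<close> off the whole theta. Hence \<open>X\<close> lies in \<open>D\<close>, whose
  closure does not contain \<open>p3\<close>.\<close>

lemma theta_region:
  assumes X: "connected X" "X \<inter> \<Theta> = {}"
    and p: "p1 \<in> path_image c1 - {a, b}" "p2 \<in> path_image c2 - {a, b}" "p3 \<in> path_image c3 - {a, b}"
    and cl: "p1 \<in> closure X" "p2 \<in> closure X" "p3 \<in> closure X"
  shows False
proof -
  interpret t: two_arcs c1 c2 a b
    by unfold_locales (use arcs ends meet in auto)
  have c3: "connected (path_image c3 - {a, b})"
    using connected_simple_path_endless[of c3] arcs ends arc_imp_simple_path by auto
  have "(path_image c3 - {a, b}) \<inter> t.J = {}" by (auto dest: meetD)
  then obtain D where D: "D \<in> components (- t.J)" "D \<inter> (path_image c3 - {a, b}) = {}"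
    using t.obtain_side_avoiding[OF c3] by metis
  have Dp: "D \<noteq> {}" "connected D" "D \<subseteq> - t.J" "frontier D = t.J"
    using in_components_nonempty[OF D(1)] in_components_connected[OF D(1)]
      in_components_subset[OF D(1)] t.component_frontier[OF D(1)] by simp_all
  have ab: "a \<in> path_image c1" "b \<in> path_image c1" "a \<in> path_image c2" "b \<in> path_image c2"
    using ends by (metis pathstart_in_path_image pathfinish_in_path_image)+
  have D3: "D \<inter> path_image c3 = {}" using D Dp ab by blast
  have clD: "p1 \<in> closure D" "p2 \<in> closure D"
    using p Dp(4) by (auto simp: closure_Un_frontier)
  obtain x where x: "x \<in> X" using cl(1) by (metis closure_empty empty_iff all_not_in_conv)
  obtain y where y: "y \<in> D" using Dp by blast
  have conn: "connected (insert p X \<union> insert p D)" if "p \<in> closure X" "p \<in> closure D" for p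
    using connected_Un[OF connected_insert_closure[OF X(1) that(1)] connected_insert_closure[OF Dp(2) that(2)]]
    by simp
  have 1: "connected_component (- (path_image c1 \<union> path_image c3)) x y"
    by (rule connected_componentI[OF conn[OF cl(2) clD(2)]]) (use p D3 Dp X x y in \<open>auto dest: meetD\<close>)
  have 2: "connected_component (- (path_image c2 \<union> path_image c3)) x y"
    by (rule connected_componentI[OF conn[OF cl(1) clD(1)]]) (use p D3 Dp X x y in \<open>auto dest: meetD\<close>)
  have "(path_image c1 \<union> path_image c3) \<inter> (path_image c2 \<union> path_image c3) = path_image c3"
    using ends_in by (auto dest: meetD)
  then have "connected_component (- ((path_image c1 \<union> path_image c3) \<union> (path_image c2 \<union> path_image c3))) x y"
    using Janiszewski[OF _ _ _ 1 2] arcs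
    by (simp add: compact_Un compact_arc_image closed_Un closed_arc_image connected_arc_image)
  then obtain T where T: "connected T" "T \<subseteq> - \<Theta>" "x \<in> T" "y \<in> T"
    unfolding connected_component_def by blast
  have "connected (X \<union> T)" using X(1) T x connected_Un by blast
  then have "X \<union> T \<subseteq> D"
    using components_maximal[OF D(1), of "X \<union> T"] X(2) T y by blast
  then have "p3 \<in> closure D" using cl(3) closure_mono[of X D] by auto
  then have "p3 \<in> D \<union> t.J" using Dp(4) closure_Un_frontier by blast
  then show False using p(3) D3 by (auto dest: meetD)
qed

text \<open>The region of \<open>X\<close> off the theta cannot touch the open arc
  \<open>c3\<close>, since it already touches the other two. Its frontier then lies on
  \<open>c1\<close> and \<open>c2\<close> only, so it is the whole side \<open>S\<close>, although
  \<open>S\<close> contains the open arc \<open>c3\<close>.\<close>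

lemma chord_separates:
  assumes S: "S \<in> components (- (path_image c1 \<union> path_image c2))"
    and c3: "path_image c3 - {a, b} \<subseteq> S" "X \<subseteq> S"
    and X: "connected X" "X \<inter> path_image c3 = {}"
    and p: "p1 \<in> path_image c1 - {a, b}" "p2 \<in> path_image c2 - {a, b}"
    and cl: "p1 \<in> closure X" "p2 \<in> closure X"
  shows False
proof -
  have XT: "X \<inter> \<Theta> = {}" using in_components_subset[OF S] c3(2) X(2) by blast
  have "X \<noteq> {}" using cl by auto
  moreover have "- \<Theta> \<noteq> {}" using \<open>X \<noteq> {}\<close> XT by blast
  ultimately obtain F where F: "F \<in> components (- \<Theta>)" "X \<subseteq> F"
    using exists_component_superset[of X "- \<Theta>"] X(1) XT by blast
  have Fp: "connected F" "F \<subseteq> - \<Theta>" "F \<noteq> {}"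
    using in_components_nonempty[OF F(1)] in_components_connected[OF F(1)]
      in_components_subset[OF F(1)] by simp_all
  have fr: "frontier F \<subseteq> \<Theta>" using frontier_component_closed[OF closed_theta F(1)] .
  have "q \<notin> closure F" if "q \<in> path_image c3 - {a, b}" for q
  proof
    assume "q \<in> closure F"
    moreover have "F \<inter> \<Theta> = {}" using Fp(2) by blast
    ultimately show False
      using theta_region[OF Fp(1) _ p that] cl closure_mono[OF F(2)] by auto
  qed
  then have fr2: "frontier F \<subseteq> path_image c1 \<union> path_image c2"
    using fr ends_in unfolding frontier_def by blast
  have "F \<in> components (- (path_image c1 \<union> path_image c2))"
    by (rule component_of_bigger_complement[OF F(1) _ fr2]) auto
  then have "F = S"
    using components_eq[OF _ S, of F] F(2) c3(2) \<open>X \<noteq> {}\<close> by auto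
  moreover have "path_image c3 - {a, b} \<noteq> {}"
    using nonempty_simple_path_endless[of c3] arcs ends arc_imp_simple_path by auto
  ultimately show False using c3(1) Fp by blast
qed

end

text \<open>\<open>X23\<close> holds the open arcs \<open>c2\<close> and \<open>c3\<close> on the
  same side of the curve formed by \<open>c1\<close> and \<open>e\<close>. The other side
  \<open>D\<close>, glued at \<open>p1\<close> to \<open>X12\<close> and \<open>X13\<close>, is a
  connected set off the theta of \<open>c2\<close>, \<open>c3\<close>, \<open>e\<close> that touches
  all three of its open arcs.\<close>

lemma no_fourth_arc:
  assumes "three_arcs c1 c2 e a b" "three_arcs c1 c3 e a b" "three_arcs c2 c3 e a b"
    and p: "p1 \<in> path_image c1 - {a, b}" "p2 \<in> path_image c2 - {a, b}" "p3 \<in> path_image c3 - {a, b}"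
    and X: "\<And>X. X \<in> {X12, X13, X23} \<Longrightarrow>
        connected X \<and> X \<inter> (path_image c1 \<union> path_image c2 \<union> path_image c3 \<union> path_image e) = {}"
    and cl: "p1 \<in> closure X12" "p2 \<in> closure X12" "p1 \<in> closure X13" "p3 \<in> closure X13"
      "p2 \<in> closure X23" "p3 \<in> closure X23"
  shows False
proof -
  interpret t12: three_arcs c1 c2 e a b by fact
  interpret t13: three_arcs c1 c3 e a b by fact
  interpret t23: three_arcs c2 c3 e a b by fact
  interpret t: two_arcs c1 e a b
    by unfold_locales (use t12.arcs t12.ends t12.meet in auto)
  let ?o = "\<lambda>c. path_image c - {a, b}"
  have o: "connected (?o c)" if "c \<in> {c2, c3, e}" for c
    using that connected_simple_path_endless[of c] t23.arcs t23.ends arc_imp_simple_path by auto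
  have 1: "connected (insert p3 (insert p2 X23))"
    using X[of X23] cl closure_mono[of X23 "insert p2 X23"]
    by (intro connected_insert_closure) auto
  have 2: "connected (?o c2 \<union> insert p3 (insert p2 X23))"
    using connected_Un[OF o[of c2] 1] p(2) by auto
  have "connected (?o c3 \<union> (?o c2 \<union> insert p3 (insert p2 X23)))"
    using connected_Un[OF o[of c3] 2] p(3) by auto
  moreover have "(?o c3 \<union> (?o c2 \<union> insert p3 (insert p2 X23))) \<inter> t.J = {}"
    using X[of X23] p by (auto dest: t12.meetD t13.meetD t23.meetD)
  ultimately obtain D where D: "D \<in> components (- t.J)"
    "D \<inter> (?o c3 \<union> (?o c2 \<union> insert p3 (insert p2 X23))) = {}"
    using t.obtain_side_avoiding by metis
  have Dp: "D \<noteq> {}" "connected D" "D \<subseteq> - t.J" "frontier D = t.J"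
    using in_components_nonempty[OF D(1)] in_components_connected[OF D(1)]
      in_components_subset[OF D(1)] t.component_frontier[OF D(1)] by simp_all
  have ab: "a \<in> path_image c1" "b \<in> path_image c1"
    using t12.ends by (metis pathstart_in_path_image pathfinish_in_path_image)+
  let ?Y = "(insert p1 D) \<union> ((insert p1 X12) \<union> (insert p1 X13))"
  have "connected ?Y"
    using X[of X12] X[of X13] cl Dp p(1)
    by (intro connected_Un connected_insert_closure) (auto simp: closure_Un_frontier)
  moreover have "?Y \<inter> t23.\<Theta> = {}"
    using p(1) D(2) Dp(3) ab X[of X12] X[of X13] by (auto dest: t12.meetD t13.meetD)
  moreover obtain q where q: "q \<in> ?o e"
    using nonempty_simple_path_endless[of e] t23.arcs t23.ends arc_imp_simple_path by auto
  moreover have cY: "closure D \<subseteq> closure ?Y" "closure X12 \<subseteq> closure ?Y" "closure X13 \<subseteq> closure ?Y"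
    by (intro closure_mono; blast)+
  moreover have "q \<in> closure ?Y"
    using q Dp(4) cY(1) by (auto simp: closure_Un_frontier)
  moreover have "p2 \<in> closure ?Y" "p3 \<in> closure ?Y"
    using cl cY by auto
  ultimately show False using t23.theta_region[of ?Y p2 p3 q] p by simp
qed

section \<open>Graphs all of whose thetas span\<close>

lemma path_edges_simps [simp]:
  "path_edges [] = {}" "path_edges [x] = {}"
  "path_edges (x # y # zs) = insert {x, y} (path_edges (y # zs))"
  by (auto simp: path_edges_def)

lemma path_edges_Cons:
  "path_edges (x # xs) = path_edges xs \<union> (if xs = [] then {} else {{x, hd xs}})"
  by (cases xs) auto

lemma path_edges_append:
  "path_edges (xs @ ys) =
     path_edges xs \<union> path_edges ys \<union> (if xs = [] \<or> ys = [] then {} else {{last xs, hd ys}})"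
  by (induction xs) (auto simp: path_edges_Cons)

lemma path_edges_split: "path_edges (xs @ y # ys) = path_edges (xs @ [y]) \<union> path_edges (y # ys)"
  by (induction xs) (auto simp: path_edges_Cons path_edges_append)

lemma path_edges_rev: "path_edges (rev xs) = path_edges xs"
  by (induction xs) (auto simp: path_edges_Cons path_edges_append last_rev insert_commute)

lemmas pe = path_edges_Cons path_edges_append path_edges_rev hd_rev last_rev

lemma path_edges_decomp:
  "e \<in> path_edges xs \<longleftrightarrow> (\<exists>u x y v. xs = u @ x # y # v \<and> e = {x, y})"
proof
  show "e \<in> path_edges xs \<Longrightarrow> \<exists>u x y v. xs = u @ x # y # v \<and> e = {x, y}"
  proof (induction xs)
    case (Cons z zs)
    show ?case
    proof (cases "e \<in> path_edges zs")
      case True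
      then show ?thesis using Cons.IH by (metis append_Cons)
    next
      case False
      then obtain y v where "zs = y # v" "e = {z, y}"
        using Cons.prems by (cases zs) auto
      then show ?thesis by (metis append_Nil)
    qed
  qed simp
qed (auto simp: pe)

lemma path_edges_vertices: "e \<in> path_edges xs \<Longrightarrow> e \<subseteq> set xs"
  by (auto simp: path_edges_decomp)

lemma path_edges_cover: "length xs \<ge> 2 \<Longrightarrow> x \<in> set xs \<Longrightarrow> \<exists>e\<in>path_edges xs. x \<in> e"
proof (induction xs)
  case (Cons y ys)
  then obtain z zs where ys: "ys = z # zs" by (cases ys) auto
  show ?case
  proof (cases "x = y \<or> x = z")
    case True
    then show ?thesis using ys by auto
  next
    case False
    then have "length ys \<ge> 2" "x \<in> set ys" using Cons.prems ys by (cases zs; auto)+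
    then show ?thesis using Cons.IH ys by auto
  qed
qed simp

lemma two_elements_decomp:
  assumes "x \<in> set L" "y \<in> set L" "x \<noteq> y"
  obtains l1 l2 l3 where "L = l1 @ x # l2 @ y # l3"
  | l1 l2 l3 where "L = l1 @ y # l2 @ x # l3"
proof -
  obtain u v where L: "L = u @ x # v" using assms(1) by (meson split_list)
  then consider "y \<in> set u" | "y \<in> set v" using assms by auto
  then show thesis
  proof cases
    case 1
    then obtain p q where "u = p @ y # q" by (meson split_list)
    then show ?thesis using L that(2) by simp
  next
    case 2
    then obtain p q where "v = p @ y # q" by (meson split_list)
    then show ?thesis using L that(1) by simp
  qed
qed

section \<open>Thetas in a graph and rerouting along an edge\<close>

text \<open>The lists hold the internal vertices. None is empty, so a cycle with a chord does not
  count; \<open>E\<close> may contain further edges among the vertices.\<close>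

definition theta :: "'v set set \<Rightarrow> 'v \<Rightarrow> 'v \<Rightarrow> 'v list \<Rightarrow> 'v list \<Rightarrow> 'v list \<Rightarrow> bool" where
  "theta E a b Q1 Q2 Q3 \<longleftrightarrow> Q1 \<noteq> [] \<and> Q2 \<noteq> [] \<and> Q3 \<noteq> [] \<and> distinct (a # b # Q1 @ Q2 @ Q3) \<and>
     path_edges (a # Q1 @ [b]) \<subseteq> E \<and> path_edges (a # Q2 @ [b]) \<subseteq> E \<and> path_edges (a # Q3 @ [b]) \<subseteq> E"

abbreviation theta_edges where
  "theta_edges a b Q1 Q2 Q3 \<equiv>
     path_edges (a # Q1 @ [b]) \<union> path_edges (a # Q2 @ [b]) \<union> path_edges (a # Q3 @ [b])"

lemma theta_swap12: "theta E a b Q1 Q2 Q3 \<Longrightarrow> theta E a b Q2 Q1 Q3"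
  and theta_swap23: "theta E a b Q1 Q2 Q3 \<Longrightarrow> theta E a b Q1 Q3 Q2"
  by (auto simp: theta_def)

lemma theta_reverse:
  assumes "theta E a b Q1 Q2 Q3"
  shows "theta E b a (rev Q1) (rev Q2) (rev Q3)"
proof -
  have "path_edges (b # rev Q @ [a]) = path_edges (a # Q @ [b])" for Q
    using path_edges_rev[of "a # Q @ [b]"] by simp
  then show ?thesis using assms by (auto simp: theta_def)
qed

text \<open>The part of type 4 that does not refer to the drawing; non-outerplanarity is supplied
  separately.\<close>

definition partial_wheel :: "'v set \<Rightarrow> 'v set set \<Rightarrow> bool" where
  "partial_wheel V E \<longleftrightarrow> (\<exists>c R S. length R \<ge> 3 \<and> distinct (c # R) \<and> V = set (c # R) \<and> S \<subseteq> set R \<and>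
        E = cycle_edges R \<union> {{c, r} | r. r \<in> S})"

text \<open>Everything that the classification of graphs with a theta uses of the drawing.\<close>

locale spanning_thetas =
  fixes V :: "'v set" and E :: "'v set set"
  assumes edge: "e \<in> E \<Longrightarrow> e \<subseteq> V \<and> card e = 2"
    and spanning: "theta E a b Q1 Q2 Q3 \<Longrightarrow> set (a # b # Q1 @ Q2 @ Q3) = V"
    and ends_nonadjacent: "theta E a b Q1 Q2 Q3 \<Longrightarrow> {a, b} \<notin> E"
begin

text \<open>Jumping along the edge from \<open>x\<close> to \<open>y\<close> gives a theta that
  misses the vertices between them on the path. The shortened path keeps an internal vertex because
  \<open>a\<close> and \<open>b\<close> are nonadjacent.\<close>

lemma no_shortcut:
  assumes T: "theta E a b Q1 Q2 Q3" and e: "{x, y} \<in> E"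
    and "x \<in> set (a # Q1 @ [b])" "y \<in> set (a # Q1 @ [b])"
  shows "{x, y} \<in> path_edges (a # Q1 @ [b])"
proof -
  have *: "{x, y} \<in> path_edges L" if L: "L = l1 @ x # l2 @ y # l3" "L = a # Q1 @ [b]" and e: "{x, y} \<in> E"
    for x y L l1 l2 l3
  proof (cases "l2 = []")
    case True
    then show ?thesis using L by (simp add: pe)
  next
    case False
    let ?L = "l1 @ x # y # l3"
    have hl: "hd ?L = a" "last ?L = b"
      using L(1)[unfolded L(2)] by (metis hd_append2 list.sel(1) append_is_Nil_conv list.distinct(1) hd_append)
        (metis L last_ConsR last_append last_snoc list.distinct(1) append_is_Nil_conv)
    have d: "distinct L" using T L(2) by (auto simp: theta_def)
    obtain Q where Q: "?L = a # Q @ [b]"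
      using hl(1,2) d L(1) by (cases ?L rule: list.exhaust; cases "tl ?L" rule: rev_exhaust) auto
    have "{a, b} \<notin> E" using ends_nonadjacent[OF T] .
    then have "Q \<noteq> []" using e Q by (cases l1; cases l3) (auto simp: insert_commute)
    have "path_edges L \<subseteq> E" using T L(2) by (simp add: theta_def)
    then have pL: "path_edges ?L \<subseteq> E"
      using e unfolding L(1) by (auto simp: pe split: if_splits)
    have dL: "distinct ?L" using d L(1) by auto
    then have dQ: "distinct Q" "a \<notin> set Q" "b \<notin> set Q" unfolding Q by auto
    have "set ?L \<subseteq> set L" using L(1) by auto
    then have QQ: "set Q \<subseteq> set Q1" using dQ unfolding Q L(2) by auto
    have pQ: "path_edges (a # Q @ [b]) \<subseteq> E" using pL unfolding Q by simp
    have "theta E a b Q Q2 Q3"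
      using T pQ dQ QQ \<open>Q \<noteq> []\<close> unfolding theta_def by auto
    then have VQ: "V = set (a # b # Q @ Q2 @ Q3)" by (rule spanning[symmetric])
    obtain z where z: "z \<in> set l2" using False by (cases l2) auto
    have "z \<notin> set ?L" using z d L(1) by auto
    then have zn: "z \<notin> set (a # Q @ [b])" unfolding Q .
    moreover have "z \<in> set (a # Q1 @ [b])" using z L by (metis Un_iff set_append set_subset_Cons subsetD)
    ultimately have zQ: "z \<in> set Q1" "z \<notin> set Q" by auto
    then have "z \<in> V" using spanning[OF T] by auto
    then show ?thesis using zQ zn T unfolding VQ theta_def by auto
  qed
  have "x \<noteq> y" using edge[OF e] by auto
  with assms(3,4) show ?thesis
  proof (rule two_elements_decomp)
    fix l1 l2 l3 assume "a # Q1 @ [b] = l1 @ x # l2 @ y # l3"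
    then show ?thesis using *[OF _ refl e] by blast
  next
    fix l1 l2 l3 assume "a # Q1 @ [b] = l1 @ y # l2 @ x # l3"
    then show ?thesis using *[OF _ refl, of l1 y l2 x l3] e by (simp add: insert_commute)
  qed
qed

text \<open>Reroute with branch vertices \<open>x\<close> and \<open>b\<close>: along
  \<open>v1\<close>, over the new edge along \<open>y # v2\<close>, and back over \<open>u1\<close>,
  through \<open>a\<close> and along \<open>Q3\<close>. This theta misses \<open>u2\<close>.\<close>

lemma cross_edge:
  assumes T: "theta E a b (u1 @ x # v1) (u2 @ y # v2) Q3" and e: "{x, y} \<in> E" and "v1 \<noteq> []"
  shows "u2 = []"
proof (rule ccontr)
  assume "u2 \<noteq> []"
  have "theta E x b v1 (y # v2) (rev u1 @ a # Q3)"
    unfolding theta_def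
  proof (intro conjI)
    have p: "path_edges (a # (u1 @ x # v1) @ [b]) \<subseteq> E" "path_edges (a # (u2 @ y # v2) @ [b]) \<subseteq> E"
      "path_edges (a # Q3 @ [b]) \<subseteq> E" "Q3 \<noteq> []"
      using T by (auto simp: theta_def)
    show "path_edges (x # v1 @ [b]) \<subseteq> E" using p(1) by (auto simp: pe)
    show "path_edges (x # (y # v2) @ [b]) \<subseteq> E" using p(2) e by (auto simp: pe)
    show "path_edges (x # (rev u1 @ a # Q3) @ [b]) \<subseteq> E"
    proof -
      have "path_edges ((x # rev u1) @ [a]) = path_edges (rev (a # u1 @ [x]))" by simp
      also have "\<dots> \<subseteq> E" unfolding path_edges_rev using p(1) by (auto simp: pe)
      finally show ?thesis
        using path_edges_split[of "x # rev u1" a "Q3 @ [b]"] p(3) by simp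
    qed
    have "distinct (a # b # (u1 @ x # v1) @ (u2 @ y # v2) @ Q3)" using T by (simp add: theta_def)
    then show "distinct (x # b # v1 @ (y # v2) @ (rev u1 @ a # Q3))" by simp blast
  qed (use \<open>v1 \<noteq> []\<close> in auto)
  note spanning[OF this, symmetric]
  moreover note spanning[OF T, symmetric]
  moreover have "hd u2 \<in> set u2" using \<open>u2 \<noteq> []\<close> by simp
  ultimately show False using T by (auto simp: theta_def)
qed

lemma cross_edge_all:
  assumes T: "theta E a b (u1 @ x # v1) (u2 @ y # v2) Q3" and e: "{x, y} \<in> E"
  shows "v1 \<noteq> [] \<Longrightarrow> u2 = []" "v2 \<noteq> [] \<Longrightarrow> u1 = []" "u1 \<noteq> [] \<Longrightarrow> v2 = []" "u2 \<noteq> [] \<Longrightarrow> v1 = []"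
proof -
  have e': "{y, x} \<in> E" using e by (simp add: insert_commute)
  show "v1 \<noteq> [] \<Longrightarrow> u2 = []" using cross_edge[OF T e] .
  show "v2 \<noteq> [] \<Longrightarrow> u1 = []" using cross_edge[OF theta_swap12[OF T] e'] .
  have R: "theta E b a (rev v1 @ x # rev u1) (rev v2 @ y # rev u2) (rev Q3)"
    using theta_reverse[OF T] by simp
  show "u1 \<noteq> [] \<Longrightarrow> v2 = []" using cross_edge[OF R e] by simp
  show "u2 \<noteq> [] \<Longrightarrow> v1 = []" using cross_edge[OF theta_swap12[OF R] e'] by simp
qed

text \<open>If \<open>x\<close> were neither first nor last on its path, nothing could lie before or
  after \<open>y\<close>, against the length of \<open>Q2\<close>. The same implications match first
  with first and last with last.\<close>

lemma cross_edge_ends: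
  assumes T: "theta E a b Q1 Q2 Q3" and e: "{x, y} \<in> E" and xy: "x \<in> set Q1" "y \<in> set Q2"
    and len: "length Q1 \<ge> 2" "length Q2 \<ge> 2"
  shows "x = hd Q1 \<and> y = hd Q2 \<or> x = last Q1 \<and> y = last Q2"
proof -
  obtain u1 v1 u2 v2 where Q: "Q1 = u1 @ x # v1" "Q2 = u2 @ y # v2"
    using xy split_list by metis
  note c = cross_edge_all[OF T[unfolded Q] e]
  show ?thesis using c len unfolding Q by (cases "u1 = []"; cases "v1 = []") auto
qed

lemma edge_cases:
  assumes T: "theta E a b Q1 Q2 Q3" and e: "e \<in> E"
  obtains "e \<in> theta_edges a b Q1 Q2 Q3"
  | x y where "e = {x, y}" "x \<in> set Q1" "y \<in> set Q2"
  | x y where "e = {x, y}" "x \<in> set Q1" "y \<in> set Q3"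
  | x y where "e = {x, y}" "x \<in> set Q2" "y \<in> set Q3"
proof -
  obtain x y where xy: "e = {x, y}" "x \<in> V" "y \<in> V"
    using edge[OF e] by (auto simp: card_2_iff)
  have V: "V = set (a # b # Q1 @ Q2 @ Q3)" by (rule spanning[OF T, symmetric])
  note s1 = no_shortcut[OF T] and s2 = no_shortcut[OF theta_swap12[OF T]]
    and s3 = no_shortcut[OF theta_swap12[OF theta_swap23[OF T]]]
  have e': "{x, y} \<in> E" "e = {y, x}" using e xy by auto
  consider "x \<in> set (a # Q1 @ [b])" "y \<in> set (a # Q1 @ [b])" | "x \<in> set (a # Q2 @ [b])" "y \<in> set (a # Q2 @ [b])"
    | "x \<in> set (a # Q3 @ [b])" "y \<in> set (a # Q3 @ [b])"
    | "x \<in> set Q1" "y \<in> set Q2" | "x \<in> set Q2" "y \<in> set Q1" | "x \<in> set Q1" "y \<in> set Q3"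
    | "x \<in> set Q3" "y \<in> set Q1" | "x \<in> set Q2" "y \<in> set Q3" | "x \<in> set Q3" "y \<in> set Q2"
    using xy(2,3) V by auto
  then show thesis
    by cases (use that xy(1) e' s1[OF e'(1)] s2[OF e'(1)] s3[OF e'(1)] in blast)+
qed

lemma theta_edges_subset: "theta E a b Q1 Q2 Q3 \<Longrightarrow> theta_edges a b Q1 Q2 Q3 \<subseteq> E"
  by (auto simp: theta_def)

section \<open>Recognising catalog types from a theta\<close>

lemma type3_if:
  assumes "theta E a b Q1 Q2 Q3" "length Q1 \<ge> 2" "length Q2 \<ge> 2" "length Q3 \<ge> 2"
    and "E = theta_edges a b Q1 Q2 Q3"
  shows "fc_type3 V E"
  using assms spanning[OF assms(1)] unfolding fc_type3_def theta_def by blast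

text \<open>The branch vertex \<open>b\<close> becomes the centre and \<open>a\<close>,
  \<open>hd Q1\<close>, \<open>hd Q2\<close> the triangle. The third leg takes in \<open>a\<close>,
  so \<open>Q3\<close> may have a single vertex.\<close>

lemma type2_if:
  assumes T: "theta E a b Q1 Q2 Q3" and len: "length Q1 \<ge> 2" "length Q2 \<ge> 2"
    and E: "E = theta_edges a b Q1 Q2 Q3 \<union> {{hd Q1, hd Q2}}"
  shows "fc_type2 V E"
  unfolding fc_type2_def
proof (intro exI conjI)
  have d: "distinct (a # b # Q1 @ Q2 @ Q3)" "Q1 \<noteq> []" "Q2 \<noteq> []" "Q3 \<noteq> []" using T by (auto simp: theta_def)
  show "length (rev Q1) \<ge> 2" "length (rev Q2) \<ge> 2" "length (rev Q3 @ [a]) \<ge> 2"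
    using len d by (cases Q3; simp)+
  show "distinct (b # rev Q1 @ rev Q2 @ (rev Q3 @ [a]))" using d by auto
  show "V = set (b # rev Q1 @ rev Q2 @ (rev Q3 @ [a]))" using spanning[OF T] by auto
  show "E = path_edges (b # rev Q1) \<union> path_edges (b # rev Q2) \<union> path_edges (b # rev Q3 @ [a]) \<union>
         {{last (rev Q1), last (rev Q2)}, {last (rev Q2), last (rev Q3 @ [a])}, {last (rev Q3 @ [a]), last (rev Q1)}}"
    unfolding E using d(2-4) by (auto simp: pe insert_commute)
qed

text \<open>The triangles are \<open>a\<close>, \<open>hd Q1\<close>, \<open>hd Q2\<close> and
  \<open>b\<close>, \<open>last Q1\<close>, \<open>last Q2\<close>; the third strut is the whole
  path through \<open>Q3\<close>.\<close>

lemma type1_if_same: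
  assumes T: "theta E a b Q1 Q2 Q3" and len: "length Q1 \<ge> 2" "length Q2 \<ge> 2"
    and E: "E = theta_edges a b Q1 Q2 Q3 \<union> {{hd Q1, hd Q2}, {last Q1, last Q2}}"
  shows "fc_type1 V E"
  unfolding fc_type1_def
proof (intro exI conjI)
  have d: "distinct (a # b # Q1 @ Q2 @ Q3)" "Q1 \<noteq> []" "Q2 \<noteq> []" "Q3 \<noteq> []" using T by (auto simp: theta_def)
  show "length Q1 \<ge> 2" "length Q2 \<ge> 2" "length (a # Q3 @ [b]) \<ge> 2"
    using len by simp_all
  show "distinct (Q1 @ Q2 @ (a # Q3 @ [b]))" using d by auto
  show "V = set (Q1 @ Q2 @ (a # Q3 @ [b]))" using spanning[OF T] by auto
  show "E = path_edges Q1 \<union> path_edges Q2 \<union> path_edges (a # Q3 @ [b]) \<union>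
         {{hd Q1, hd Q2}, {hd Q2, hd (a # Q3 @ [b])}, {hd (a # Q3 @ [b]), hd Q1}} \<union>
         {{last Q1, last Q2}, {last Q2, last (a # Q3 @ [b])}, {last (a # Q3 @ [b]), last Q1}}"
    unfolding E using d(2-4) by (auto simp: pe insert_commute)
qed

text \<open>The triangles are \<open>a\<close>, \<open>hd Q1\<close>, \<open>hd Q2\<close> and
  \<open>b\<close>, \<open>last Q2\<close>, \<open>last Q3\<close>. The struts along
  \<open>Q1\<close> and \<open>Q3\<close> are lengthened by \<open>b\<close> and \<open>a\<close>,
  so these two lists may have a single vertex.\<close>

lemma type1_if_different:
  assumes T: "theta E a b Q1 Q2 Q3" and len: "length Q2 \<ge> 2"
    and E: "E = theta_edges a b Q1 Q2 Q3 \<union> {{hd Q1, hd Q2}, {last Q2, last Q3}}"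
  shows "fc_type1 V E"
  unfolding fc_type1_def
proof (intro exI conjI)
  have d: "distinct (a # b # Q1 @ Q2 @ Q3)" "Q1 \<noteq> []" "Q2 \<noteq> []" "Q3 \<noteq> []" using T by (auto simp: theta_def)
  show "length (Q1 @ [b]) \<ge> 2" "length Q2 \<ge> 2" "length (a # Q3) \<ge> 2"
    using len d by (cases Q1; cases Q3; simp)+
  show "distinct ((Q1 @ [b]) @ Q2 @ (a # Q3))" using d by auto
  show "V = set ((Q1 @ [b]) @ Q2 @ (a # Q3))" using spanning[OF T] by auto
  show "E = path_edges (Q1 @ [b]) \<union> path_edges Q2 \<union> path_edges (a # Q3) \<union>
         {{hd (Q1 @ [b]), hd Q2}, {hd Q2, hd (a # Q3)}, {hd (a # Q3), hd (Q1 @ [b])}} \<union>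
         {{last (Q1 @ [b]), last Q2}, {last Q2, last (a # Q3)}, {last (a # Q3), last (Q1 @ [b])}}"
    unfolding E using d(2-4) by (auto simp: pe insert_commute)
qed

text \<open>The vertex \<open>w\<close> becomes the centre and the other two paths the rim. By
  \<open>no_shortcut\<close> an edge within one path is a path edge, so every edge off the rim ends
  at \<open>w\<close>.\<close>

lemma partial_wheel_if:
  assumes T: "theta E a b Q1 Q2 [w]"
    and nocross: "\<And>x y. x \<in> set Q1 \<Longrightarrow> y \<in> set Q2 \<Longrightarrow> {x, y} \<notin> E"
  shows "partial_wheel V E"
  unfolding partial_wheel_def
proof (intro exI conjI)
  let ?R = "a # Q1 @ b # rev Q2" and ?S = "{r \<in> set (a # Q1 @ b # rev Q2). {w, r} \<in> E}"
  have d: "distinct (a # b # Q1 @ Q2 @ [w])" "Q1 \<noteq> []" "Q2 \<noteq> []" using T by (auto simp: theta_def)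
  show "length ?R \<ge> 3" using d by (cases Q1; simp)
  show "distinct (w # ?R)" using d by auto
  show V: "V = set (w # ?R)" using spanning[OF T] by auto
  show "?S \<subseteq> set ?R" by auto
  have R: "cycle_edges ?R = path_edges (a # Q1 @ [b]) \<union> path_edges (a # Q2 @ [b])"
    using d(2,3) by (auto simp: cycle_edges_def pe insert_commute)
  have "e \<in> cycle_edges ?R \<union> {{w, r} |r. r \<in> ?S}" if e: "e \<in> E" for e
    using T e
  proof (cases rule: edge_cases)
    case 1
    have "{a, w} \<in> E" "{w, b} \<in> E" using T by (auto simp: theta_def)
    then show ?thesis using 1 R by (auto simp: insert_commute)
  next
    case (2 x y)
    then show ?thesis using nocross e by blast
  next
    case (3 x y)
    then have "e = {w, x}" "x \<in> ?S" using e by (auto simp: insert_commute)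
    then show ?thesis by blast
  next
    case (4 x y)
    then have "e = {w, x}" "x \<in> ?S" using e by (auto simp: insert_commute)
    then show ?thesis by blast
  qed
  moreover have "cycle_edges ?R \<subseteq> E" using theta_edges_subset[OF T] R by blast
  ultimately show "E = cycle_edges ?R \<union> {{w, r} |r. r \<in> ?S}" by blast
qed

text \<open>Two edges among the neighbours of a branch vertex give a theta that misses this vertex.\<close>

lemma no_two_head_edges:
  assumes T: "theta E a b Q1 Q2 Q3" and len: "length Q2 \<ge> 2"
  shows "\<not> ({hd Q1, hd Q2} \<in> E \<and> {hd Q2, hd Q3} \<in> E)"
proof
  assume e: "{hd Q1, hd Q2} \<in> E \<and> {hd Q2, hd Q3} \<in> E"
  obtain h t where Q2: "Q2 = h # t" "t \<noteq> []" using len by (cases Q2; cases "tl Q2") auto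
  have "theta E h b Q1 t Q3"
    unfolding theta_def
  proof (intro conjI)
    have p: "path_edges (a # Q1 @ [b]) \<subseteq> E" "path_edges (a # (h # t) @ [b]) \<subseteq> E"
      "path_edges (a # Q3 @ [b]) \<subseteq> E" and ne: "Q1 \<noteq> []" "Q3 \<noteq> []"
      using T Q2 by (auto simp: theta_def)
    show "path_edges (h # Q1 @ [b]) \<subseteq> E" using p(1) ne e Q2 by (auto simp: pe insert_commute)
    show "path_edges (h # t @ [b]) \<subseteq> E" using p(2) by auto
    show "path_edges (h # Q3 @ [b]) \<subseteq> E" using p(3) ne e Q2 by (auto simp: pe)
    show "distinct (h # b # Q1 @ t @ Q3)" using T Q2 by (auto simp: theta_def)
  qed (use T Q2 in \<open>auto simp: theta_def\<close>)
  note spanning[OF this, symmetric]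
  moreover note spanning[OF T, symmetric]
  ultimately show False using T Q2 by (auto simp: theta_def)
qed

section \<open>Thetas with three long paths\<close>

text \<open>Cross edges join two heads or two lasts. The given edge is the only one at the heads,
  and at most one occurs at the lasts. None there gives type 2; one on the same pair of paths or on
  another pair gives the two presentations of type 1.\<close>

lemma subdivided_if_head_edge:
  assumes T: "theta E a b Q1 Q2 Q3" and len: "length Q1 \<ge> 2" "length Q2 \<ge> 2" "length Q3 \<ge> 2"
    and h: "{hd Q1, hd Q2} \<in> E"
  shows "fc_type1 V E \<or> fc_type2 V E"
proof -
  let ?l12 = "{last Q1, last Q2}" and ?l13 = "{last Q1, last Q3}" and ?l23 = "{last Q2, last Q3}"
  note sw = theta_swap12[OF T] theta_swap23[OF T] theta_swap12[OF theta_swap23[OF T]]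
    theta_swap23[OF theta_swap12[OF T]]
  have nh: "{hd Q2, hd Q3} \<notin> E" "{hd Q1, hd Q3} \<notin> E"
    using no_two_head_edges[OF T len(2)] no_two_head_edges[OF sw(1) len(1)] h
    by (auto simp: insert_commute)
  have ne: "Q1 \<noteq> []" "Q2 \<noteq> []" "Q3 \<noteq> []" using T by (auto simp: theta_def)
  have nl: "\<not> (?l12 \<in> E \<and> ?l23 \<in> E)" "\<not> (?l12 \<in> E \<and> ?l13 \<in> E)" "\<not> (?l13 \<in> E \<and> ?l23 \<in> E)"
    using no_two_head_edges[OF theta_reverse[OF T]] no_two_head_edges[OF theta_reverse[OF sw(1)]]
      no_two_head_edges[OF theta_reverse[OF sw(2)]] len ne
    by (auto simp: insert_commute hd_rev)
  have sub: "e \<in> theta_edges a b Q1 Q2 Q3 \<union> {{hd Q1, hd Q2}} \<union> ({?l12, ?l13, ?l23} \<inter> E)" if "e \<in> E" for e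
    using T that
  proof (cases rule: edge_cases)
    case (2 x y)
    then show ?thesis using cross_edge_ends[OF T, of x y] len that by auto
  next
    case (3 x y)
    then show ?thesis using cross_edge_ends[OF sw(2), of x y] len that nh by auto
  next
    case (4 x y)
    then show ?thesis using cross_edge_ends[OF sw(4), of x y] len that nh by auto
  qed auto
  have E: "E = theta_edges a b Q1 Q2 Q3 \<union> {{hd Q1, hd Q2}} \<union> ({?l12, ?l13, ?l23} \<inter> E)"
    using sub theta_edges_subset[OF T] h by blast
  consider "?l12 \<in> E" "?l13 \<notin> E" "?l23 \<notin> E" | "?l13 \<in> E" "?l12 \<notin> E" "?l23 \<notin> E"
    | "?l23 \<in> E" "?l12 \<notin> E" "?l13 \<notin> E" | "?l12 \<notin> E" "?l13 \<notin> E" "?l23 \<notin> E"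
    using nl by blast
  then show ?thesis
  proof cases
    case 1
    then have "E = theta_edges a b Q1 Q2 Q3 \<union> {{hd Q1, hd Q2}, ?l12}" using E by blast
    then show ?thesis using type1_if_same[OF T len(1,2)] by blast
  next
    case 2
    then have "E = theta_edges a b Q2 Q1 Q3 \<union> {{hd Q2, hd Q1}, ?l13}" using E by (auto simp: insert_commute)
    then show ?thesis using type1_if_different[OF sw(1) len(1)] by blast
  next
    case 3
    then have "E = theta_edges a b Q1 Q2 Q3 \<union> {{hd Q1, hd Q2}, ?l23}" using E by blast
    then show ?thesis using type1_if_different[OF T len(2)] by blast
  next
    case 4
    then have "E = theta_edges a b Q1 Q2 Q3 \<union> {{hd Q1, hd Q2}}" using E by blast
    then show ?thesis using type2_if[OF T len(1,2)] by blast
  qed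
qed

lemma subdivided_if_long:
  assumes T: "theta E a b Q1 Q2 Q3" and len: "length Q1 \<ge> 2" "length Q2 \<ge> 2" "length Q3 \<ge> 2"
  shows "fc_type1 V E \<or> fc_type2 V E \<or> fc_type3 V E"
proof -
  note sw = theta_swap12[OF T] theta_swap23[OF T] theta_swap12[OF theta_swap23[OF T]]
    theta_swap23[OF theta_swap12[OF T]]
  note rv = theta_reverse[OF T] theta_reverse[OF sw(2)] theta_reverse[OF sw(4)]
  have ne: "Q1 \<noteq> []" "Q2 \<noteq> []" "Q3 \<noteq> []" using T by (auto simp: theta_def)
  show ?thesis
  proof (cases "{hd Q1, hd Q2} \<in> E \<or> {hd Q1, hd Q3} \<in> E \<or> {hd Q2, hd Q3} \<in> E \<or>
      {last Q1, last Q2} \<in> E \<or> {last Q1, last Q3} \<in> E \<or> {last Q2, last Q3} \<in> E")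
    case True
    then show ?thesis
      using subdivided_if_head_edge[OF T] subdivided_if_head_edge[OF sw(2)] subdivided_if_head_edge[OF sw(4)]
        subdivided_if_head_edge[OF rv(1)] subdivided_if_head_edge[OF rv(2)] subdivided_if_head_edge[OF rv(3)]
        len ne by (auto simp: hd_rev)
  next
    case False
    have "e \<in> theta_edges a b Q1 Q2 Q3" if "e \<in> E" for e
      using T that
    proof (cases rule: edge_cases)
      case (2 x y)
      then show ?thesis using cross_edge_ends[OF T, of x y] len that False by auto
    next
      case (3 x y)
      then show ?thesis using cross_edge_ends[OF sw(2), of x y] len that False by auto
    next
      case (4 x y)
      then show ?thesis using cross_edge_ends[OF sw(4), of x y] len that False by auto
    qed
    then have "E = theta_edges a b Q1 Q2 Q3" using theta_edges_subset[OF T] by blast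
    then show ?thesis using type3_if[OF T len] by blast
  qed
qed

text \<open>For any other \<^term>\<open>y\<close> the two given edges yield a theta that misses \<^term>\<open>a\<close>.\<close>

lemma middle_edge_last:
  assumes T: "theta E a b Q1 Q2 [w]" and h: "{hd Q1, hd Q2} \<in> E"
    and y: "y \<in> set Q1" "{w, y} \<in> E"
  shows "y = last Q1"
proof -
  obtain u v where Q1: "Q1 = u @ y # v" using y(1) by (meson split_list)
  have "v = []"
  proof (rule ccontr)
    assume "v \<noteq> []"
    have "theta E b y [w] (rev v) (rev Q2 @ u)"
      unfolding theta_def
    proof (intro conjI)
      have p: "path_edges (a # (u @ y # v) @ [b]) \<subseteq> E" "path_edges (a # Q2 @ [b]) \<subseteq> E"
        "path_edges (a # [w] @ [b]) \<subseteq> E" "Q2 \<noteq> []"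
        using T Q1 by (auto simp: theta_def)
      show "path_edges (b # [w] @ [y]) \<subseteq> E" using p(3) y by (auto simp: insert_commute)
      show "path_edges (b # rev v @ [y]) \<subseteq> E"
        using p(1) \<open>v \<noteq> []\<close> by (auto simp: pe insert_commute)
      show "path_edges (b # (rev Q2 @ u) @ [y]) \<subseteq> E"
        using p(1,2,4) h Q1 by (cases "u = []") (auto simp: pe insert_commute)
      show "distinct (b # y # [w] @ rev v @ (rev Q2 @ u))" using T Q1 by (auto simp: theta_def)
    qed (use T \<open>v \<noteq> []\<close> in \<open>auto simp: theta_def\<close>)
    note spanning[OF this, symmetric]
    moreover note spanning[OF T, symmetric]
    ultimately show False using T Q1 by (auto simp: theta_def)
  qed
  then show ?thesis using Q1 by simp
qed

text \<open>The two edges at \<open>w\<close> give a theta with branch vertices \<open>w\<close> and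
  \<open>hd Q1\<close>, through \<open>a\<close>, through the rest of \<open>Q1\<close> and through
  \<open>Q2\<close>. It misses \<open>b\<close>.\<close>

lemma not_both_last:
  assumes T: "theta E a b Q1 Q2 [w]" and h: "{hd Q1, hd Q2} \<in> E" and len: "length Q1 \<ge> 2"
  shows "\<not> ({w, last Q1} \<in> E \<and> {w, last Q2} \<in> E)"
proof
  assume l: "{w, last Q1} \<in> E \<and> {w, last Q2} \<in> E"
  obtain x t where Q1: "Q1 = x # t" "t \<noteq> []" using len by (cases Q1; cases "tl Q1") auto
  have "theta E w x [a] (rev t) (rev Q2)"
    unfolding theta_def
  proof (intro conjI)
    have p: "path_edges (a # (x # t) @ [b]) \<subseteq> E" "path_edges (a # Q2 @ [b]) \<subseteq> E"
      "path_edges (a # [w] @ [b]) \<subseteq> E" "Q2 \<noteq> []"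
      using T Q1 by (auto simp: theta_def)
    show "path_edges (w # [a] @ [x]) \<subseteq> E" using p(1,3) by (auto simp: insert_commute)
    show "path_edges (w # rev t @ [x]) \<subseteq> E" using p(1) Q1 l by (auto simp: pe insert_commute)
    show "path_edges (w # rev Q2 @ [x]) \<subseteq> E" using p(2,4) l h Q1 by (auto simp: pe insert_commute)
    show "distinct (w # x # [a] @ rev t @ rev Q2)" using T Q1 by (auto simp: theta_def)
  qed (use T Q1 in \<open>auto simp: theta_def\<close>)
  note spanning[OF this, symmetric]
  moreover note spanning[OF T, symmetric]
  ultimately show False using T Q1 by (auto simp: theta_def)
qed

section \<open>Thetas with a path of one internal vertex\<close>

text \<open>Beyond the given edge only \<open>?l\<close>, \<open>?w1\<close> and \<open>?w2\<close>
  can occur, and any two of them exclude each other. Since \<open>w\<close> is the last vertex of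
  its own path, \<open>?w1\<close> and \<open>?w2\<close> lead to type 1 with the triangle at
  \<open>b\<close> on a different pair of paths.\<close>

lemma one_short_path_head_edge:
  assumes T: "theta E a b Q1 Q2 [w]" and len: "length Q1 \<ge> 2" "length Q2 \<ge> 2"
    and h: "{hd Q1, hd Q2} \<in> E"
  shows "fc_type1 V E \<or> fc_type2 V E"
proof -
  let ?l = "{last Q1, last Q2}" and ?w1 = "{last Q1, w}" and ?w2 = "{last Q2, w}"
  note sw = theta_swap12[OF T] theta_swap23[OF T] theta_swap12[OF theta_swap23[OF T]]
    theta_swap23[OF theta_swap12[OF T]]
  have h': "{hd Q2, hd Q1} \<in> E" using h by (simp add: insert_commute)
  have d: "distinct Q1" "distinct Q2" "Q1 \<noteq> []" "Q2 \<noteq> []" using T by (auto simp: theta_def)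
  have sub: "e \<in> theta_edges a b Q1 Q2 [w] \<union> {{hd Q1, hd Q2}} \<union> ({?l, ?w1, ?w2} \<inter> E)" if "e \<in> E" for e
    using T that
  proof (cases rule: edge_cases)
    case (2 x y)
    then have "e = {hd Q1, hd Q2} \<or> e = ?l" using cross_edge_ends[OF T _ 2(2,3) len] that by auto
    then show ?thesis using that by blast
  next
    case (3 x y)
    then have "x = last Q1" "y = w"
      using middle_edge_last[OF T h, of x] that by (auto simp: insert_commute)
    then show ?thesis using 3 that by auto
  next
    case (4 x y)
    then have "x = last Q2" "y = w"
      using middle_edge_last[OF sw(1) h', of x] that by (auto simp: insert_commute)
    then show ?thesis using 4 that by auto
  qed auto
  have E: "E = theta_edges a b Q1 Q2 [w] \<union> {{hd Q1, hd Q2}} \<union> ({?l, ?w1, ?w2} \<inter> E)"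
    using sub theta_edges_subset[OF T] h by blast
  have hl: "hd Q \<noteq> last Q" if "distinct Q" "length Q \<ge> 2" for Q :: "'v list"
    using that by (cases Q) auto
  \<comment> \<open>Read from \<open>b\<close>, the edge \<open>?l\<close> is a head edge. A
    neighbour of \<open>w\<close> on \<open>Q1\<close> or \<open>Q2\<close> would then have to be
    the vertex next to \<open>a\<close>, which differs from the last one.\<close>
  have "?w1 \<notin> E \<and> ?w2 \<notin> E" if "?l \<in> E"
  proof -
    have R: "theta E b a (rev Q1) (rev Q2) [w]" using theta_reverse[OF T] by simp
    have "{hd (rev Q1), hd (rev Q2)} \<in> E" "{hd (rev Q2), hd (rev Q1)} \<in> E"
      using that d by (auto simp: hd_rev insert_commute)
    then show ?thesis
      using middle_edge_last[OF R, of "last Q1"] middle_edge_last[OF theta_swap12[OF R], of "last Q2"]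
        d hl[OF d(1) len(1)] hl[OF d(2) len(2)] by (auto simp: last_rev insert_commute)
  qed
  moreover have "\<not> (?w1 \<in> E \<and> ?w2 \<in> E)"
    using not_both_last[OF T h len(1)] by (auto simp: insert_commute)
  ultimately consider "?l \<in> E" "?w1 \<notin> E" "?w2 \<notin> E" | "?l \<notin> E" "?w1 \<in> E" "?w2 \<notin> E"
    | "?l \<notin> E" "?w1 \<notin> E" "?w2 \<in> E" | "?l \<notin> E" "?w1 \<notin> E" "?w2 \<notin> E"
    by blast
  then show ?thesis
  proof cases
    case 1
    then have "E = theta_edges a b Q1 Q2 [w] \<union> {{hd Q1, hd Q2}, ?l}" using E by blast
    then show ?thesis using type1_if_same[OF T len(1,2)] by blast
  next
    case 2
    then have "E = theta_edges a b Q1 Q2 [w] \<union> {{hd Q1, hd Q2}} \<union> {?w1}" using E by blast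
    also have "\<dots> = theta_edges a b Q2 Q1 [w] \<union> {{hd Q2, hd Q1}, {last Q1, last [w]}}"
      by (auto simp: insert_commute)
    finally show ?thesis using type1_if_different[OF sw(1) len(1)] by blast
  next
    case 3
    then have "E = theta_edges a b Q1 Q2 [w] \<union> {{hd Q1, hd Q2}} \<union> {?w2}" using E by blast
    also have "\<dots> = theta_edges a b Q1 Q2 [w] \<union> {{hd Q1, hd Q2}, {last Q2, last [w]}}"
      by auto
    finally show ?thesis using type1_if_different[OF T len(2)] by blast
  next
    case 4
    then have "E = theta_edges a b Q1 Q2 [w] \<union> {{hd Q1, hd Q2}}" using E by blast
    then show ?thesis using type2_if[OF T len(1,2)] by blast
  qed
qed

section \<open>Thetas with two paths of one internal vertex\<close>

text \<open>Three reroutings over both spokes. A nonempty \<open>q1\<close> gives a theta with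
  branch vertices \<open>s\<close>, \<open>a\<close> that misses \<open>b\<close>; a nonempty
  \<open>q3\<close> gives one with branch vertices \<open>t\<close>, \<open>b\<close> that misses
  \<open>a\<close>. In any case \<open>u\<close> and \<open>w\<close> are branch vertices of a theta
  through \<open>a\<close>, through \<open>b\<close> and along the segment from \<open>s\<close> to
  \<open>t\<close>.\<close>

lemma spokes_ordered:
  assumes T: "theta E a b [u] (q1 @ s # q2 @ t # q3) [w]" and e: "{u, s} \<in> E" "{w, t} \<in> E"
  shows "q1 = []" "q3 = []" "{u, w} \<notin> E"
proof -
  let ?Q = "q1 @ s # q2 @ t # q3"
  have p: "path_edges (a # [u] @ [b]) \<subseteq> E" "path_edges (a # ?Q @ [b]) \<subseteq> E"
      "path_edges (a # [w] @ [b]) \<subseteq> E"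
    using T by (auto simp: theta_def)
  have d: "distinct (a # b # [u] @ ?Q @ [w])" using T unfolding theta_def by blast
  note sp = spanning[OF T, symmetric]
  show "q1 = []"
  proof (rule ccontr)
    assume q: "q1 \<noteq> []"
    have "theta E s a [u] (rev q1) (q2 @ [t, w])"
      unfolding theta_def
    proof (intro conjI)
      show "path_edges (s # [u] @ [a]) \<subseteq> E" using p(1) e by (auto simp: insert_commute)
      show "path_edges (s # rev q1 @ [a]) \<subseteq> E" using p(2) q by (auto simp: pe insert_commute)
      show "path_edges (s # (q2 @ [t, w]) @ [a]) \<subseteq> E"
        using p(2,3) e by (cases "q2 = []") (auto simp: pe insert_commute)
      show "distinct (s # a # [u] @ rev q1 @ (q2 @ [t, w]))" using d by auto
    qed (use q in auto)
    from spanning[OF this, symmetric] sp d show False by auto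
  qed
  show "q3 = []"
  proof (rule ccontr)
    assume q: "q3 \<noteq> []"
    have "theta E t b [w] q3 (rev q2 @ [s, u])"
      unfolding theta_def
    proof (intro conjI)
      show "path_edges (t # [w] @ [b]) \<subseteq> E" using p(3) e by (auto simp: insert_commute)
      show "path_edges (t # q3 @ [b]) \<subseteq> E" using p(2) q by (auto simp: pe)
      show "path_edges (t # (rev q2 @ [s, u]) @ [b]) \<subseteq> E"
        using p(1,2) e by (cases "q2 = []") (auto simp: pe insert_commute)
      show "distinct (t # b # [w] @ q3 @ (rev q2 @ [s, u]))" using d by auto
    qed (use q in auto)
    from spanning[OF this, symmetric] sp d show False by auto
  qed
  have "theta E u w [a] [b] (s # q2 @ [t])"
    unfolding theta_def
  proof (intro conjI)
    show "path_edges (u # [a] @ [w]) \<subseteq> E" "path_edges (u # [b] @ [w]) \<subseteq> E"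
      using p(1,3) by (auto simp: insert_commute)
    show "path_edges (u # (s # q2 @ [t]) @ [w]) \<subseteq> E"
      using p(2) e by (cases "q2 = []") (auto simp: pe insert_commute)
    show "distinct (u # w # [a] @ [b] @ (s # q2 @ [t]))" using d by auto
  qed auto
  then show "{u, w} \<notin> E" by (rule ends_nonadjacent)
qed

text \<open>With \<open>t\<close> as a common neighbour, \<open>u\<close> and \<open>w\<close> are
  branch vertices of a theta whose internal vertices are just \<open>t\<close>, \<open>a\<close> and
  \<open>b\<close>; it has to span.\<close>

lemma common_spoke:
  assumes T: "theta E a b [u] Q2 [w]" and t: "t \<in> set Q2" and e: "{u, t} \<in> E" "{w, t} \<in> E"
  shows "Q2 = [t]" "{u, w} \<notin> E"
proof -
  have d: "distinct (a # b # [u] @ Q2 @ [w])" using T unfolding theta_def by blast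
  have U: "theta E u w [t] [a] [b]"
    using T t e by (auto simp: theta_def insert_commute)
  have "set Q2 \<subseteq> {t}" using spanning[OF T] spanning[OF U] d by auto
  then show "Q2 = [t]" using d t by (cases Q2; cases "tl Q2") auto
  show "{u, w} \<notin> E" using ends_nonadjacent[OF U] .
qed

text \<open>By \<open>spokes_ordered\<close> the middle path begins at \<open>s\<close> and ends at
  \<open>t\<close>. Any further spoke of \<open>u\<close> or \<open>w\<close> breaks this order or
  is a common spoke, so exactly the two given edges are added to the theta and the graph is a
  subdivided prism.\<close>

lemma two_short_paths_ordered:
  assumes T: "theta E a b [u] (q1 @ s # q2 @ t # q3) [w]" and e: "{u, s} \<in> E" "{w, t} \<in> E"
  shows "fc_type1 V E"
proof -
  note o = spokes_ordered[OF T e]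
  let ?Q = "s # q2 @ [t]"
  have T: "theta E a b [u] ?Q [w]" using T o by simp
  have d: "distinct ?Q" using T by (auto simp: theta_def)
  have us: "x = s" if x: "x \<in> set ?Q" "{u, x} \<in> E" for x
  proof -
    consider "x = t" | "x \<in> set q2" | "x = s" using x by auto
    then show ?thesis
    proof cases
      case 1
      then show ?thesis using common_spoke(1)[OF T _ _ e(2)] x by auto
    next
      case 2
      then obtain p q where "q2 = p @ x # q" by (meson split_list)
      then have "theta E a b [u] ((s # p) @ x # q @ t # []) [w]" using T by simp
      from spokes_ordered(1)[OF this x(2) e(2)] show ?thesis by simp
    qed
  qed
  have wt: "x = t" if x: "x \<in> set ?Q" "{w, x} \<in> E" for x
  proof -
    consider "x = s" | "x \<in> set q2" | "x = t" using x by auto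
    then show ?thesis
    proof cases
      case 1
      then show ?thesis using common_spoke(1)[OF T _ e(1)] x by auto
    next
      case 2
      then obtain p q where "q2 = p @ x # q" by (meson split_list)
      then have "theta E a b [u] ([] @ s # p @ x # (q @ [t])) [w]" using T by simp
      from spokes_ordered(2)[OF this e(1) x(2)] show ?thesis by simp
    qed
  qed
  have "f \<in> theta_edges a b [u] ?Q [w] \<union> {{u, s}, {t, w}}" if f: "f \<in> E" for f
    using T f
  proof (cases rule: edge_cases)
    case (2 x y)
    then show ?thesis using us[of y] f by auto
  next
    case (3 x y)
    then show ?thesis using o(3) f by auto
  next
    case (4 x y)
    then have "y = w" by simp
    then show ?thesis using wt[of x] 4 f by (auto simp: insert_commute)
  qed auto
  moreover have "{{u, s}, {t, w}} \<subseteq> E" using e by (auto simp: insert_commute)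
  ultimately have "E = theta_edges a b [u] ?Q [w] \<union> {{u, s}, {t, w}}"
    using theta_edges_subset[OF T] by blast
  then show ?thesis using type1_if_different[OF T] by simp
qed

text \<open>Without a spoke at \<open>w\<close> the graph is a wheel with centre \<open>u\<close>.
  If the spoke of \<open>w\<close> also ends at \<open>s\<close>, then \<open>s\<close> is all of
  \<open>Q2\<close> and is the centre. Spokes at distinct vertices give the prism.\<close>

lemma two_short_paths:
  assumes T: "theta E a b [u] Q2 [w]" and s: "s \<in> set Q2" "{u, s} \<in> E"
  shows "fc_type1 V E \<or> partial_wheel V E"
proof (cases "\<exists>t\<in>set Q2. {w, t} \<in> E")
  case False
  have "theta E a b Q2 [w] [u]" using T by (auto simp: theta_def)
  then have "partial_wheel V E"
    by (rule partial_wheel_if) (use False in \<open>auto simp: insert_commute\<close>)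
  then show ?thesis ..
next
  case True
  then obtain t where t: "t \<in> set Q2" "{w, t} \<in> E" by blast
  show ?thesis
  proof (cases "s = t")
    case True
    note c = common_spoke[OF T t(1) s(2)[unfolded True] t(2)]
    have "theta E a b [u] [w] [t]" using theta_swap23[OF T] c by simp
    then have "partial_wheel V E"
      by (rule partial_wheel_if) (use c in auto)
    then show ?thesis ..
  next
    case False
    show ?thesis
    proof (rule two_elements_decomp[OF s(1) t(1) False])
      fix l1 l2 l3 assume "Q2 = l1 @ s # l2 @ t # l3"
      then show ?thesis using two_short_paths_ordered T s(2) t(2) by metis
    next
      fix l1 l2 l3 assume Q2: "Q2 = l1 @ t # l2 @ s # l3"
      have "theta E a b [w] (l1 @ t # l2 @ s # l3) [u]" using T Q2 by (auto simp: theta_def)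
      then show ?thesis using two_short_paths_ordered s(2) t(2) by metis
    qed
  qed
qed

lemma one_short_path:
  assumes T: "theta E a b Q1 Q2 [w]"
  shows "fc_type1 V E \<or> fc_type2 V E \<or> partial_wheel V E"
proof (cases "\<exists>x\<in>set Q1. \<exists>y\<in>set Q2. {x, y} \<in> E")
  case False
  then show ?thesis using partial_wheel_if[OF T] by blast
next
  case True
  then obtain x y where xy: "x \<in> set Q1" "y \<in> set Q2" "{x, y} \<in> E" by blast
  have ne: "Q1 \<noteq> []" "Q2 \<noteq> []" using T by (auto simp: theta_def)
  have sing: "\<exists>u. Q = [u]" if "Q \<noteq> []" "\<not> length Q \<ge> 2" for Q :: "'v list"
    using that by (cases Q; cases "tl Q") auto
  consider "length Q1 \<ge> 2" "length Q2 \<ge> 2" | u where "Q1 = [u]" | u where "Q2 = [u]"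
    using sing ne by blast
  then show ?thesis
  proof cases
    case 1
    consider "{hd Q1, hd Q2} \<in> E" | "{last Q1, last Q2} \<in> E"
      using cross_edge_ends[OF T xy(3,1,2) 1] xy(3) by auto
    then show ?thesis
    proof cases
      case a: 1
      then show ?thesis using one_short_path_head_edge[OF T 1] by blast
    next
      case 2
      have "theta E b a (rev Q1) (rev Q2) [w]" using theta_reverse[OF T] by simp
      then show ?thesis using one_short_path_head_edge[of b a "rev Q1" "rev Q2" w] 1 2 ne by (auto simp: hd_rev)
    qed
  next
    case 2
    then show ?thesis using two_short_paths[of a b u Q2 w y] T xy by auto
  next
    case 3
    have "theta E a b [u] Q1 [w]" using theta_swap12[OF T] 3 by simp
    then show ?thesis using two_short_paths[of a b u Q1 w x] xy 3 by (auto simp: insert_commute)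
  qed
qed

theorem theta_classification:
  assumes T: "theta E a b Q1 Q2 Q3"
  shows "fc_type1 V E \<or> fc_type2 V E \<or> fc_type3 V E \<or> partial_wheel V E"
proof -
  have sing: "\<exists>u. Q = [u]" if "Q \<noteq> []" "\<not> length Q \<ge> 2" for Q :: "'v list"
    using that by (cases Q; cases "tl Q") auto
  have ne: "Q1 \<noteq> []" "Q2 \<noteq> []" "Q3 \<noteq> []" using T by (auto simp: theta_def)
  consider "length Q1 \<ge> 2" "length Q2 \<ge> 2" "length Q3 \<ge> 2" | u where "Q1 = [u]"
    | u where "Q2 = [u]" | u where "Q3 = [u]"
    using sing ne by blast
  then show ?thesis
  proof cases
    case 1
    then show ?thesis using subdivided_if_long[OF T] by blast
  next
    case 2
    then have "theta E a b Q2 Q3 [u]" using theta_swap23[OF theta_swap12[OF T]] by simp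
    then show ?thesis using one_short_path by blast
  next
    case 3
    then have "theta E a b Q1 Q3 [u]" using theta_swap23[OF T] by simp
    then show ?thesis using one_short_path by blast
  next
    case 4
    then show ?thesis using T one_short_path by blast
  qed
qed

end

section \<open>Longest cycles in theta-free graphs\<close>

definition is_cycle :: "'v set set \<Rightarrow> 'v list \<Rightarrow> bool" where
  "is_cycle E Z \<longleftrightarrow> length Z \<ge> 3 \<and> distinct Z \<and> cycle_edges Z \<subseteq> E"

definition longest_cycle :: "'v set set \<Rightarrow> 'v list \<Rightarrow> bool" where
  "longest_cycle E Z \<longleftrightarrow> is_cycle E Z \<and> (\<forall>Z'. is_cycle E Z' \<longrightarrow> length Z' \<le> length Z)"

lemma cycle_edges_eq: "Z \<noteq> [] \<Longrightarrow> cycle_edges Z = insert {last Z, hd Z} (path_edges Z)"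
  by (auto simp: cycle_edges_def path_edges_append)

lemma cycle_edges_two_arcs:
  "cycle_edges (a # p @ b # q) = path_edges (a # p @ [b]) \<union> path_edges (a # rev q @ [b])"
proof -
  have "path_edges (a # rev q @ [b]) = path_edges (b # q @ [a])"
    using path_edges_rev[of "b # q @ [a]"] by simp
  moreover have "cycle_edges (a # p @ b # q) = path_edges (a # p @ [b]) \<union> path_edges (b # q @ [a])"
    unfolding cycle_edges_def using path_edges_split[of "a # p" b "q @ [a]"] by simp
  ultimately show ?thesis by simp
qed

lemma cycle_edges_rotate: "cycle_edges (xs @ ys) = cycle_edges (ys @ xs)"
  by (cases "xs = []"; cases "ys = []") (auto simp: cycle_edges_eq pe)

lemma is_cycle_rotate: "is_cycle E (xs @ ys) \<Longrightarrow> is_cycle E (ys @ xs)"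
  by (auto simp: is_cycle_def cycle_edges_rotate)

lemma longest_cycle_rotate: "longest_cycle E (xs @ ys) \<Longrightarrow> longest_cycle E (ys @ xs)"
  unfolding longest_cycle_def using is_cycle_rotate by (auto simp: add.commute)

lemma is_cycle_vertices:
  assumes "is_cycle E Z" "x \<in> set Z"
  shows "\<exists>e\<in>cycle_edges Z. x \<in> e"
proof -
  obtain u v where "Z = u @ x # v" using assms(2) by (meson split_list)
  then have "cycle_edges Z = cycle_edges (x # v @ u)"
    using cycle_edges_rotate[of u "x # v"] by simp
  then show ?thesis by (auto simp: cycle_edges_eq)
qed

section \<open>Reachability and vertex connectivity one\<close>

text \<open>The relation inside \<open>graph_connected\<close>, with the vertex set \<open>W\<close>
  free: deleting vertices restricts \<open>W\<close> and leaves \<open>E\<close> alone.\<close>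

definition adj :: "'v set set \<Rightarrow> 'v set \<Rightarrow> 'v \<Rightarrow> 'v \<Rightarrow> bool" where
  "adj E W a b \<longleftrightarrow> {a, b} \<in> E \<and> a \<in> W \<and> b \<in> W"

lemma graph_connected_adj:
  "graph_connected V E \<longleftrightarrow> V \<noteq> {} \<and> (\<forall>u\<in>V. \<forall>v\<in>V. (adj E V)\<^sup>*\<^sup>* u v)"
  unfolding graph_connected_def adj_def by simp

lemma adj_reach_sym: "(adj E W)\<^sup>*\<^sup>* u v \<Longrightarrow> (adj E W)\<^sup>*\<^sup>* v u"
proof (induction rule: rtranclp_induct)
  case (step y z)
  then have "adj E W z y" by (auto simp: adj_def insert_commute)
  then show ?case using step by (meson converse_rtranclp_into_rtranclp)
qed simp

lemma adj_reach_in: "(adj E W)\<^sup>*\<^sup>* u v \<Longrightarrow> u \<in> W \<Longrightarrow> v \<in> W"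
  by (induction rule: rtranclp_induct) (auto simp: adj_def)

lemma adj_reach_path:
  assumes "(adj E W)\<^sup>*\<^sup>* u v" "u \<in> W"
  shows "\<exists>p. p \<noteq> [] \<and> hd p = u \<and> last p = v \<and> distinct p \<and> set p \<subseteq> W \<and> path_edges p \<subseteq> E"
  using assms(1)
proof (induction rule: rtranclp_induct)
  case base
  then show ?case using assms(2) by (intro exI[of _ "[u]"]) simp
next
  case (step y z)
  then obtain p where p: "p \<noteq> []" "hd p = u" "last p = y" "distinct p" "set p \<subseteq> W" "path_edges p \<subseteq> E"
    by blast
  show ?case
  proof (cases "z \<in> set p")
    case True
    then obtain s t where st: "p = s @ z # t" by (meson split_list)
    have "path_edges (s @ [z]) \<subseteq> E" using p(6) path_edges_split[of s z t] st by simp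
    moreover have "hd (s @ [z]) = u" using p(2) st by (cases s) auto
    ultimately show ?thesis using p st by (intro exI[of _ "s @ [z]"]) auto
  next
    case False
    then show ?thesis using p step(2)
      by (intro exI[of _ "p @ [z]"]) (auto simp: pe adj_def)
  qed
qed

lemma path_adj_reach:
  assumes "path_edges p \<subseteq> E" "set p \<subseteq> W" "x \<in> set p" "y \<in> set p"
  shows "(adj E W)\<^sup>*\<^sup>* x y"
proof -
  have hd: "(adj E W)\<^sup>*\<^sup>* (hd q) z" if "path_edges q \<subseteq> E" "set q \<subseteq> W" "z \<in> set q" for q z
    using that
  proof (induction q)
    case (Cons a q)
    show ?case
    proof (cases "z = a")
      case False
      then obtain b r where q: "q = b # r" using Cons.prems by (cases q) auto
      then have "(adj E W)\<^sup>*\<^sup>* b z" using Cons False by auto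
      moreover have "adj E W a b" using Cons.prems q by (auto simp: adj_def)
      ultimately show ?thesis by (simp add: converse_rtranclp_into_rtranclp)
    qed simp
  qed simp
  show ?thesis using adj_reach_sym[OF hd[OF assms(1-3)]] hd[OF assms(1,2,4)] by (rule rtranclp_trans)
qed

text \<open>The second alternative in \<open>cut\<close> covers K_2, where deleting a vertex leaves
  a single vertex and disconnects nothing.\<close>

lemma vertex_connectivity_one:
  assumes "finite V" "graph_connected V E" "card V \<ge> 2" "s \<in> V"
    and cut: "\<not> (\<forall>u\<in>V - {s}. \<forall>v\<in>V - {s}. (adj E (V - {s}))\<^sup>*\<^sup>* u v) \<or> card (V - {s}) \<le> 1"
  shows "vertex_connectivity V E = 1"
  unfolding vertex_connectivity_def
proof (rule Least_equality)
  have "adj {e \<in> E. e \<inter> {s} = {}} (V - {s}) = adj E (V - {s})"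
    by (auto simp: adj_def fun_eq_iff)
  then show "\<exists>S\<subseteq>V. card S = 1 \<and> (\<not> graph_connected (V - S) {e \<in> E. e \<inter> S = {}} \<or> card (V - S) \<le> 1)"
    using assms(4) cut unfolding graph_connected_adj by (intro exI[of _ "{s}"]) auto
next
  fix k assume "\<exists>S\<subseteq>V. card S = k \<and> (\<not> graph_connected (V - S) {e \<in> E. e \<inter> S = {}} \<or> card (V - S) \<le> 1)"
  then obtain S where S: "S \<subseteq> V" "card S = k"
    "\<not> graph_connected (V - S) {e \<in> E. e \<inter> S = {}} \<or> card (V - S) \<le> 1" by blast
  have "S \<noteq> {}" using S(3) assms(2,3) by auto
  then show "1 \<le> k" using S(1,2) assms(1) finite_subset[of S V] by (cases k) auto
qed

section \<open>Attachments to a longest cycle\<close>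

locale theta_free =
  fixes V :: "'v set" and E :: "'v set set"
  assumes fin: "finite V" and edge: "e \<in> E \<Longrightarrow> e \<subseteq> V \<and> card e = 2"
    and no_theta: "\<not> theta E a b Q1 Q2 Q3"
begin

lemma is_cycle_in: "is_cycle E Z \<Longrightarrow> set Z \<subseteq> V"
  using is_cycle_vertices edge unfolding is_cycle_def by (metis subset_iff is_cycle_def)

lemma longest_cycle_exists:
  assumes "is_cycle E C"
  obtains Z where "longest_cycle E Z"
proof -
  have "length Z < Suc (card V)" if "is_cycle E Z" for Z
    using card_mono[OF fin is_cycle_in[OF that]] that distinct_card[of Z]
    by (simp add: is_cycle_def less_Suc_eq_le)
  then have "\<exists>Z. is_cycle E Z \<and> (\<forall>Z'. is_cycle E Z' \<longrightarrow> length Z' \<le> length Z)"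
    using assms by (intro ex_has_greatest_nat[where b = "Suc (card V)"]) (auto intro: less_imp_le)
  then show thesis using that unfolding longest_cycle_def by blast
qed

text \<open>If both arcs of \<open>Z\<close> between \<open>x\<close> and \<open>y\<close> have
  internal vertices, \<open>p\<close> is the third path of a theta; otherwise \<open>x\<close> and
  \<open>y\<close> are consecutive on \<open>Z\<close> and the detour over \<open>p\<close>
  lengthens the cycle.\<close>

lemma no_ear:
  assumes Z: "longest_cycle E Z" and xy: "x \<in> set Z" "y \<in> set Z" "x \<noteq> y"
    and p: "p \<noteq> []" "distinct p" "set p \<inter> set Z = {}" "path_edges (x # p @ [y]) \<subseteq> E"
  shows False
proof -
  have *: False if L: "longest_cycle E (x # z1 @ y # z2)" and p: "p \<noteq> []" "distinct p"
    "set p \<inter> set (x # z1 @ y # z2) = {}" "path_edges (x # p @ [y]) \<subseteq> E"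
    for x y z1 z2 p
  proof -
    have c: "distinct (x # z1 @ y # z2)" "path_edges (x # z1 @ [y]) \<subseteq> E" "path_edges (x # rev z2 @ [y]) \<subseteq> E"
      using L unfolding longest_cycle_def is_cycle_def cycle_edges_two_arcs by auto
    have maxi: "length Z' \<le> length (x # z1 @ y # z2)" if "is_cycle E Z'" for Z'
      using L that unfolding longest_cycle_def by blast
    have "theta E x y p z1 (rev z2)" if "z1 \<noteq> []" "z2 \<noteq> []"
      unfolding theta_def using that p c by auto
    then consider "z1 = []" | "z2 = []" using no_theta by blast
    then show False
    proof cases
      case 1
      have "cycle_edges (x # p @ y # z2) \<subseteq> E" unfolding cycle_edges_two_arcs using p c by simp
      then have "is_cycle E (x # p @ y # z2)"
        using L p c 1 unfolding is_cycle_def longest_cycle_def by (auto simp: Suc_le_eq)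
      then show False using maxi[of "x # p @ y # z2"] p(1) 1 by simp
    next
      case 2
      have "cycle_edges (x # z1 @ y # rev p) \<subseteq> E" unfolding cycle_edges_two_arcs using p c by simp
      then have "is_cycle E (x # z1 @ y # rev p)"
        using L p c 2 unfolding is_cycle_def longest_cycle_def by (auto simp: Suc_le_eq)
      then show False using maxi[of "x # z1 @ y # rev p"] p(1) 2 by simp
    qed
  qed
  have p': "rev p \<noteq> []" "distinct (rev p)" "set (rev p) \<inter> set Z = {}" "path_edges (y # rev p @ [x]) \<subseteq> E"
    using p path_edges_rev[of "x # p @ [y]"] by auto
  show False
  proof (rule two_elements_decomp[OF xy])
    fix l1 l2 l3 assume Zd: "Z = l1 @ x # l2 @ y # l3"
    have "longest_cycle E (x # l2 @ y # (l3 @ l1))"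
      using longest_cycle_rotate[of E l1 "x # l2 @ y # l3"] Z Zd by simp
    then show False by (rule *[OF _ p(1,2) _ p(4)]) (use p(3) Zd in auto)
  next
    fix l1 l2 l3 assume Zd: "Z = l1 @ y # l2 @ x # l3"
    have "longest_cycle E (y # l2 @ x # (l3 @ l1))"
      using longest_cycle_rotate[of E l1 "y # l2 @ x # l3"] Z Zd by simp
    then show False by (rule *[OF _ p'(1,2) _ p'(4)]) (use p(3) Zd in auto)
  qed
qed

text \<open>For \<open>w\<close> off \<open>Z\<close> this is the component of \<open>w\<close> in
  the graph without \<open>Z\<close>.\<close>

abbreviation blob where "blob Z w \<equiv> {u. (adj E (V - set Z))\<^sup>*\<^sup>* w u}"

lemma blob_attaches_once:
  assumes Z: "longest_cycle E Z" and w: "w \<in> V - set Z"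
    and z: "z \<in> set Z" "z' \<in> set Z" and b: "b \<in> blob Z w" "b' \<in> blob Z w" "{b, z} \<in> E" "{b', z'} \<in> E"
  shows "z = z'"
proof (rule ccontr)
  assume "z \<noteq> z'"
  have "(adj E (V - set Z))\<^sup>*\<^sup>* b b'"
    using b(1,2) adj_reach_sym by (metis mem_Collect_eq rtranclp_trans)
  moreover have "b \<in> V - set Z" using b(1) w adj_reach_in by (metis mem_Collect_eq)
  ultimately obtain p where p: "p \<noteq> []" "hd p = b" "last p = b'" "distinct p" "set p \<subseteq> V - set Z" "path_edges p \<subseteq> E"
    using adj_reach_path by metis
  have "path_edges (z # p @ [z']) \<subseteq> E" using p b by (auto simp: pe insert_commute)
  then show False using no_ear[OF Z z \<open>z \<noteq> z'\<close> p(1,4)] p(5) by blast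
qed

text \<open>If \<open>z\<close> has no neighbour in the component of \<open>w\<close>, each of the
  two arcs of \<open>C\<close> from \<open>z\<close> to \<open>w\<close> has an inner vertex on
  \<open>Z\<close> from which it enters that component for good. Both vertices are the unique
  attachment, but the two arcs share no inner vertex.\<close>

lemma cycle_through_blob:
  assumes Z: "longest_cycle E Z" and C: "is_cycle E C"
    and w: "w \<in> set C" "w \<notin> set Z" and z: "z \<in> set C" "z \<in> set Z"
  shows "\<exists>b\<in>blob Z w. {b, z} \<in> E"
proof (rule ccontr)
  assume no: "\<not> ?thesis"
  obtain u v where "C = u @ z # v" using z by (meson split_list)
  then have C1: "is_cycle E (z # v @ u)" using is_cycle_rotate[of E u "z # v"] C by simp
  have "w \<in> set (v @ u)" using w z \<open>C = u @ z # v\<close> by auto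
  then obtain c1 c2 where c: "v @ u = c1 @ w # c2" by (meson split_list)
  have C2: "is_cycle E (z # c1 @ w # c2)" using C1 c by simp
  have W: "set (z # c1 @ w # c2) \<subseteq> V" using is_cycle_in[OF C2] .
  have pe1: "path_edges (z # c1 @ [w]) \<subseteq> E" "path_edges (z # rev c2 @ [w]) \<subseteq> E"
    using C2 unfolding is_cycle_def cycle_edges_two_arcs by auto
  have *: "\<exists>z'\<in>set c. z' \<in> set Z \<and> (\<exists>b\<in>blob Z w. {b, z'} \<in> E)"
    if p: "path_edges (z # c @ [w]) \<subseteq> E" and cV: "set c \<subseteq> V" for c
  proof -
    have key: "\<exists>b\<in>blob Z w. {b, x} \<in> E" if x: "path_edges (x # d @ [w]) \<subseteq> E" "set d \<inter> set Z = {}" "set d \<subseteq> V" for x d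
    proof -
      have "path_edges (d @ [w]) \<subseteq> E" using x(1) by (auto simp: pe split: if_splits)
      moreover have "set (d @ [w]) \<subseteq> V - set Z" using x W w by auto
      moreover have "hd (d @ [w]) \<in> set (d @ [w])" by (rule hd_in_set) simp
      ultimately have "hd (d @ [w]) \<in> blob Z w"
        using path_adj_reach[of "d @ [w]" E "V - set Z" w "hd (d @ [w])"] by simp
      moreover have "{hd (d @ [w]), x} \<in> E" using x(1) by (auto simp: path_edges_Cons insert_commute)
      ultimately show ?thesis by blast
    qed
    have "\<exists>x\<in>set c. x \<in> set Z"
    proof (rule ccontr)
      assume "\<not> ?thesis"
      then show False using key[OF p] cV no by blast
    qed
    \<comment> \<open>The last vertex of \<open>Z\<close> before \<open>w\<close>: from there on the
      arc stays off \<open>Z\<close>, so the next vertex lies in the component of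
      \<open>w\<close>.\<close>
    then obtain d1 x d2 where d: "c = d1 @ x # d2" "x \<in> set Z" "\<forall>y\<in>set d2. y \<notin> set Z"
      using split_list_last_prop[of c "\<lambda>x. x \<in> set Z"] by blast
    have "path_edges (x # d2 @ [w]) \<subseteq> E"
      using p path_edges_split[of "z # d1" x "d2 @ [w]"] d(1) by simp
    then have "\<exists>b\<in>blob Z w. {b, x} \<in> E" by (rule key) (use d cV in auto)
    then show ?thesis using d by auto
  qed
  obtain z1 where z1: "z1 \<in> set c1" "z1 \<in> set Z" "\<exists>b\<in>blob Z w. {b, z1} \<in> E"
    using *[OF pe1(1)] W by auto
  obtain z2 where z2: "z2 \<in> set c2" "z2 \<in> set Z" "\<exists>b\<in>blob Z w. {b, z2} \<in> E"
    using *[OF pe1(2)] W by auto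
  have "w \<in> V - set Z" using W w by auto
  then have "z1 = z2" using blob_attaches_once[OF Z _ z1(2) z2(2)] z1(3) z2(3) by blast
  then show False using z1 z2 C2 by (auto simp: is_cycle_def)
qed

text \<open>The cycle has two distinct vertices, and at most one of them is an attachment. This
  supplies a vertex nonadjacent to \<open>w\<close>, which must share a face with it.\<close>

lemma blob_avoids_vertex:
  assumes Z: "longest_cycle E Z" and w: "w \<in> V - set Z"
  obtains z where "z \<in> set Z" "\<And>b. b \<in> blob Z w \<Longrightarrow> {b, z} \<notin> E"
proof -
  have "length Z \<ge> 3" "distinct Z" using Z by (auto simp: longest_cycle_def is_cycle_def)
  then obtain z z' where z: "z \<in> set Z" "z' \<in> set Z" "z \<noteq> z'"
    by (cases Z; cases "tl Z") auto
  then show thesis using that blob_attaches_once[OF Z w z(1,2)] by blast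
qed

text \<open>Connectedness forces the component of \<open>w\<close> to attach to \<open>Z\<close>,
  and it does so at a single vertex \<open>s\<close>. Deleting \<open>s\<close> cuts
  \<open>w\<close> off from the other vertices of \<open>Z\<close>.\<close>

lemma vertex_connectivity_one_if_not_spanning:
  assumes Z: "longest_cycle E Z" and w: "w \<in> V - set Z" and con: "graph_connected V E"
  shows "vertex_connectivity V E = 1"
proof -
  have ZV: "set Z \<subseteq> V" using Z is_cycle_in unfolding longest_cycle_def by blast
  obtain z0 where z0: "z0 \<in> set Z" "\<And>b. b \<in> blob Z w \<Longrightarrow> {b, z0} \<notin> E"
    using blob_avoids_vertex[OF Z w] by blast
  have bV: "blob Z w \<subseteq> V - set Z" using adj_reach_in w by fastforce
  have closed: "v \<in> blob Z w" if "u \<in> blob Z w" "{u, v} \<in> E" "v \<notin> set Z" for u v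
  proof -
    have "adj E (V - set Z) u v" using that bV edge[OF that(2)] by (auto simp: adj_def)
    then show ?thesis using that(1) by (auto intro: rtranclp.rtrancl_into_rtrancl)
  qed
  have stay: "v \<in> blob Z w" if "(adj E W)\<^sup>*\<^sup>* w v" "\<And>u z. u \<in> blob Z w \<Longrightarrow> z \<in> set Z \<inter> W \<Longrightarrow> {u, z} \<notin> E" for W v
    using that(1)
  proof (induction rule: rtranclp_induct)
    case (step y x)
    then show ?case using closed that(2) unfolding adj_def by blast
  qed simp
  have "z0 \<notin> blob Z w" using bV z0 by blast
  moreover have "(adj E V)\<^sup>*\<^sup>* w z0" using con w ZV z0 unfolding graph_connected_adj by blast
  ultimately obtain u s where s: "u \<in> blob Z w" "s \<in> set Z" "{u, s} \<in> E" using stay by blast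
  have "z0 \<noteq> s" using s z0 by blast
  have "\<not> (adj E (V - {s}))\<^sup>*\<^sup>* w z0"
    using stay[of "V - {s}" z0] \<open>z0 \<notin> blob Z w\<close> blob_attaches_once[OF Z w _ s(2) _ s(1) _ s(3)] by blast
  moreover have "w \<in> V - {s}" "z0 \<in> V - {s}" using w s z0 ZV \<open>z0 \<noteq> s\<close> by auto
  moreover have "card V \<ge> 2"
    using card_mono[OF fin, of "{w, z0}"] w z0 ZV by (auto simp: card_insert_if split: if_splits)
  ultimately show ?thesis using vertex_connectivity_one[OF fin con, of s] s ZV by blast
qed

text \<open>Otherwise deleting one vertex never disconnects. Then \<open>u\<close> has a neighbour
  \<open>v\<close>, and a second one because it reaches a further vertex without \<open>v\<close>. A
  path that joins these two without \<open>u\<close> closes a cycle.\<close>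

lemma vertex_connectivity_one_if_acyclic:
  assumes no: "\<And>C. \<not> is_cycle E C" and con: "graph_connected V E" and card: "card V \<ge> 2"
  shows "vertex_connectivity V E = 1"
proof (rule ccontr)
  assume n: "vertex_connectivity V E \<noteq> 1"
  have c: "(adj E (V - {s}))\<^sup>*\<^sup>* u v" "card (V - {s}) \<ge> 2" if "s \<in> V" "u \<in> V - {s}" "v \<in> V - {s}" for s u v
  proof -
    have "\<not> (\<not> (\<forall>u\<in>V - {s}. \<forall>v\<in>V - {s}. (adj E (V - {s}))\<^sup>*\<^sup>* u v) \<or> card (V - {s}) \<le> 1)"
      using vertex_connectivity_one[OF fin con card that(1)] n by blast
    then show "(adj E (V - {s}))\<^sup>*\<^sup>* u v" "card (V - {s}) \<ge> 2" using that(2,3) by auto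
  qed
  obtain T where "T \<subseteq> V" "card T = 2" by (rule obtain_subset_with_card_n[OF card])
  moreover from this obtain u x where "T = {u, x}" "x \<noteq> u" using card_2_iff[of T] by metis
  ultimately have u: "u \<in> V" and x: "x \<in> V" "x \<noteq> u" by auto
  have first: "\<exists>v. {u, v} \<in> E \<and> v \<in> W" if "(adj E W)\<^sup>*\<^sup>* u x" for W
    using that x(2) by (metis adj_def converse_rtranclpE)
  obtain v where v: "{u, v} \<in> E" "v \<in> V"
    using first[of V] con u x unfolding graph_connected_adj by blast
  have uv: "u \<noteq> v" using edge[OF v(1)] by auto
  have "card (V - {v}) \<ge> 2" using c(2)[OF v(2)] u uv by blast
  then have "V - {v} \<noteq> {u}" by (metis card.empty card_insert_disjoint empty_iff finite.emptyI le_numeral_extra(4) numeral_le_one_iff One_nat_def semiring_norm(69))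
  then obtain y where y: "y \<in> V" "y \<noteq> v" "y \<noteq> u" using u uv by blast
  have "(adj E (V - {v}))\<^sup>*\<^sup>* u y" using c(1)[OF v(2)] u uv y by blast
  then obtain v' where v': "{u, v'} \<in> E" "v' \<in> V - {v}"
    using y(3) by (metis adj_def converse_rtranclpE)
  have "u \<noteq> v'" using edge[OF v'(1)] by auto
  then have "(adj E (V - {u}))\<^sup>*\<^sup>* v v'" using c(1)[OF u] v v' uv by blast
  then obtain p where p: "p \<noteq> []" "hd p = v" "last p = v'" "distinct p" "set p \<subseteq> V - {u}" "path_edges p \<subseteq> E"
    using adj_reach_path[of E "V - {u}" v v'] v uv by blast
  have "length p \<ge> 2" using p v' by (cases p; cases "tl p") auto
  then have "is_cycle E (u # p)"
    using p v v' by (auto simp: is_cycle_def cycle_edges_eq path_edges_Cons insert_commute)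
  then show False using no by blast
qed

text \<open>The chord ends cut the cycle into four segments. A vertex inside a segment yields a
  theta whose branch vertices are the ends of that segment and whose other two paths use one chord
  each. So the cycle has four vertices and the graph is K_4, presented as the wheel with rim
  \<open>a\<close>, \<open>c\<close>, \<open>b\<close> and centre \<open>d\<close>.\<close>

lemma crossing_chords:
  assumes Z: "is_cycle E (a # z1 @ b # z2)" "set (a # z1 @ b # z2) = V"
    and e: "{a, b} \<in> E" "{c, d} \<in> E" and cd: "c \<in> set z1" "d \<in> set z2"
  shows "z1 = [c]" "z2 = [d]" "partial_wheel V E"
proof -
  obtain u1 u2 where z1: "z1 = u1 @ c # u2" using cd by (meson split_list)
  obtain v1 v2 where z2: "z2 = v1 @ d # v2" using cd by (meson split_list)
  have dd: "distinct (a # (u1 @ c # u2) @ b # (v1 @ d # v2))" using Z z1 z2 by (simp add: is_cycle_def)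
  have "path_edges (a # u1 @ c # u2 @ b # v1 @ d # v2 @ [a]) \<subseteq> E"
    using Z z1 z2 by (simp add: is_cycle_def cycle_edges_def)
  then have p: "path_edges (a # u1 @ [c]) \<subseteq> E" "path_edges (c # u2 @ [b]) \<subseteq> E"
    "path_edges (b # v1 @ [d]) \<subseteq> E" "path_edges (d # v2 @ [a]) \<subseteq> E"
    using path_edges_split[of "a # u1" c "u2 @ b # v1 @ d # v2 @ [a]"]
      path_edges_split[of "c # u2" b "v1 @ d # v2 @ [a]"]
      path_edges_split[of "b # v1" d "v2 @ [a]"] by auto
  have r: "path_edges (c # rev u1 @ [a]) \<subseteq> E" "path_edges (b # rev u2 @ [c]) \<subseteq> E"
    "path_edges (d # rev v1 @ [b]) \<subseteq> E" "path_edges (a # rev v2 @ [d]) \<subseteq> E"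
    using p path_edges_rev[of "a # u1 @ [c]"] path_edges_rev[of "c # u2 @ [b]"]
      path_edges_rev[of "b # v1 @ [d]"] path_edges_rev[of "d # v2 @ [a]"] by simp_all
  have e': "{b, a} \<in> E" "{d, c} \<in> E" using e by (simp_all add: insert_commute)
  have "theta E a c u1 (b # rev u2) (rev v2 @ [d])" if "u1 \<noteq> []"
    unfolding theta_def using that dd p r e e' path_edges_split[of "a # rev v2" d "[c]"] by auto
  moreover have "theta E c b u2 (rev u1 @ [a]) (d # rev v1)" if "u2 \<noteq> []"
    unfolding theta_def using that dd p r e e' path_edges_split[of "c # rev u1" a "[b]"] by auto
  moreover have "theta E b d v1 (rev u2 @ [c]) (a # rev v2)" if "v1 \<noteq> []"
    unfolding theta_def using that dd p r e e' path_edges_split[of "b # rev u2" c "[d]"] by auto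
  moreover have "theta E d a v2 (c # rev u1) (rev v1 @ [b])" if "v2 \<noteq> []"
    unfolding theta_def using that dd p r e e' path_edges_split[of "d # rev v1" b "[a]"] by auto
  ultimately have n: "u1 = []" "u2 = []" "v1 = []" "v2 = []" using no_theta by blast+
  then show zz: "z1 = [c]" "z2 = [d]" using z1 z2 by auto
  have V: "V = {a, b, c, d}" using Z(2) zz by auto
  have s1: "f \<in> {{a, c}, {c, b}, {b, a}, {d, a}, {d, c}, {d, b}}" if f: "f \<in> E" for f
  proof -
    obtain x y where "f = {x, y}" "x \<noteq> y" "x \<in> V" "y \<in> V"
      using edge[OF f] by (auto simp: card_2_iff)
    then show ?thesis unfolding V by (auto simp: doubleton_eq_iff)
  qed
  have "{a, c} \<in> E" "{c, b} \<in> E" "{d, a} \<in> E" "{b, d} \<in> E"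
    using p n by simp_all
  then have s2: "{{a, c}, {c, b}, {b, a}, {d, a}, {d, c}, {d, b}} \<subseteq> E"
    using e e' by (simp add: insert_commute[of d b])
  have E: "E = {{a, c}, {c, b}, {b, a}, {d, a}, {d, c}, {d, b}}"
    by (rule equalityI[OF subsetI[OF s1] s2])
  show "partial_wheel V E"
    unfolding partial_wheel_def
  proof (intro exI conjI)
    show "E = cycle_edges [a, c, b] \<union> {{d, r} |r. r \<in> {a, b, c}}"
      unfolding E by (auto simp: cycle_edges_def)
  qed (use dd V n in auto)
qed

end

section \<open>Plane drawings\<close>

text \<open>Suppose \<open>F\<close> stays away from the start of \<open>c\<close>. Cutting off a
  short initial piece leaves an arc \<open>?g\<close> and does not enlarge \<open>F\<close>. Neither
  \<open>K\<close> nor \<open>?g\<close> separates \<open>F\<close> from the piece cut off: the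
  first because one can pass from \<open>F\<close> through \<open>p\<close> along \<open>c\<close>,
  the second because an arc never separates. They meet in one point, so Janiszewski's theorem joins
  \<open>F\<close> to a point of the piece, which lies outside \<open>F\<close>.\<close>

lemma region_touching_edge_interior:
  fixes c :: "real \<Rightarrow> complex"
  assumes K: "closed K" and c: "arc c" "path_image c \<inter> K \<subseteq> {pathstart c, pathfinish c}" "pathfinish c \<in> K"
    and F: "F \<in> components (- (K \<union> path_image c))"
    and p: "p \<in> path_image c - {pathstart c, pathfinish c}" "p \<in> closure F"
  shows "pathstart c \<in> closure F"
proof (rule ccontr)
  assume "pathstart c \<notin> closure F"
  then obtain r where r: "r > 0" "ball (pathstart c) r \<inter> closure F = {}"
    by (metis closed_closure openE open_Compl ComplI disjoint_eq_subset_Compl)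
  have inj: "inj_on c {0..1}" and cont: "continuous_on {0..1} c"
    using c(1) by (auto simp: arc_def path_def)
  obtain d where d: "d > 0" "\<And>t. t \<in> {0..1} \<Longrightarrow> dist t 0 < d \<Longrightarrow> dist (c t) (c 0) < r"
    using cont r(1) unfolding continuous_on_iff by (metis atLeastAtMost_iff order_refl zero_le_one)
  \<comment> \<open>\<open>d/2\<close> keeps the piece over \<open>{0..s}\<close> inside the ball;
    \<open>1/2\<close> keeps \<open>s\<close> below 1, so that the rest is still an arc.\<close>
  define s where "s = min (1/2) (d/2)"
  have s: "0 < s" "s < 1" using d by (auto simp: s_def)
  have sb: "c t \<in> ball (pathstart c) r" if "0 \<le> t" "t \<le> s" for t
  proof -
    have "t \<in> {0..1}" "dist t 0 < d" using that d(1) by (auto simp: s_def dist_real_def)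
    then have "dist (c t) (c 0) < r" by (rule d(2))
    then show ?thesis by (simp add: pathstart_def dist_commute[of "c 0"])
  qed
  let ?g = "subpath s 1 c"
  have g: "arc ?g" by (rule arc_subpath_arc[OF c(1)]) (use s in auto)
  have gi: "path_image ?g = c ` {s..1}" using s by (simp add: path_image_subpath)
  have "{0..1::real} = {0..s} \<union> {s..1}" using s by auto
  then have ci: "path_image c = c ` {0..s} \<union> path_image ?g"
    unfolding gi by (metis image_Un path_image_def)
  have small: "c t \<notin> path_image ?g" if "0 \<le> t" "t < s" for t
  proof
    assume "c t \<in> path_image ?g"
    then obtain t' where t': "c t = c t'" "s \<le> t'" "t' \<le> 1" unfolding gi by auto
    then have "t = t'" using inj_onD[OF inj t'(1)] that s by auto
    then show False using that t' by simp
  qed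
  have gK: "path_image ?g \<inter> K = {pathfinish c}"
  proof -
    have "pathstart c \<notin> path_image ?g"
      unfolding pathstart_def using small[of 0] s by simp
    moreover have "pathfinish c \<in> path_image ?g" unfolding gi pathfinish_def using s by auto
    ultimately show ?thesis using c(2,3) ci by auto
  qed
  have clg: "closed (K \<union> path_image ?g)" "closed (K \<union> path_image c)"
    using K g c(1) by (simp_all add: closed_Un closed_arc_image)
  have fr: "frontier F \<subseteq> K \<union> path_image ?g"
  proof
    fix x assume x: "x \<in> frontier F"
    then have "x \<in> K \<union> path_image c" using frontier_component_closed[OF clg(2) F] by blast
    moreover have "x \<notin> c ` {0..s}"
    proof
      assume "x \<in> c ` {0..s}"
      then have "x \<in> ball (pathstart c) r" using sb by auto
      moreover have "x \<in> closure F" using x by (simp add: frontier_def)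
      ultimately show False using r(2) by blast
    qed
    ultimately show "x \<in> K \<union> path_image ?g" using ci by blast
  qed
  have F1: "F \<in> components (- (K \<union> path_image ?g))"
    by (rule component_of_bigger_complement[OF F _ fr]) (use ci in blast)
  have Fp: "F \<noteq> {}" "connected F" "F \<subseteq> - (K \<union> path_image c)"
    using in_components_nonempty[OF F] in_components_connected[OF F] in_components_subset[OF F] by auto
  let ?o = "path_image c - {pathstart c, pathfinish c}"
  obtain x where x: "x \<in> F" using Fp by blast
  let ?q = "c (s/2)"
  have q: "?q \<in> ?o"
    using simple_path_endless[OF arc_imp_simple_path[OF c(1)]] s by auto
  have qg: "?q \<notin> path_image ?g" using small[of "s/2"] s by simp
  have qF: "?q \<notin> F"
    using sb[of "s/2"] s r(2) closure_subset[of F] by auto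
  have "connected (insert p F \<union> ?o)"
    using connected_Un[OF connected_insert_closure[OF Fp(2) p(2)]
        connected_simple_path_endless[OF arc_imp_simple_path[OF c(1)]]] p(1) by auto
  moreover have "insert p F \<union> ?o \<subseteq> - K" using Fp(3) p(1) c(2) by auto
  ultimately have 1: "connected_component (- K) x ?q"
    by (rule connected_componentI) (use x q in auto)
  have "connected (- path_image ?g)" using connected_arc_complement[OF g] by simp
  then have 2: "connected_component (- path_image ?g) x ?q"
    by (rule connected_componentI[OF _ order_refl]) (use x Fp(3) ci qg in auto)
  have "connected_component (- (path_image ?g \<union> K)) x ?q"
    using Janiszewski[OF compact_arc_image[OF g] K _ 2 1] gK by simp
  then obtain T where T: "connected T" "T \<subseteq> - (K \<union> path_image ?g)" "x \<in> T" "?q \<in> T"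
    unfolding connected_component_def by (metis Un_commute)
  have "T \<subseteq> F" using components_maximal[OF F1 T(1,2)] T x by blast
  then show False using T(4) qF by blast
qed

section \<open>Edges and paths as arcs of the drawing\<close>

locale plane_drawing =
  fixes V :: "'v set" and E :: "'v set set"
    and pos :: "'v \<Rightarrow> complex" and gam :: "'v set \<Rightarrow> real \<Rightarrow> complex"
  assumes plane: "plane_graph V E pos gam"
begin

abbreviation D where "D A \<equiv> \<Union>e\<in>A. path_image (gam e)"

lemma finV: "finite V"
  using plane by (simp add: plane_graph_def)

lemma edge: "e \<in> E \<Longrightarrow> e \<subseteq> V \<and> card e = 2"
  using plane by (simp add: plane_graph_def)

lemma inj: "inj_on pos V"
  using plane by (simp add: plane_graph_def)

lemma arcs: "e \<in> E \<Longrightarrow> arc (gam e)"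
  using plane by (simp add: plane_graph_def)

lemma ends: "e \<in> E \<Longrightarrow> {pathstart (gam e), pathfinish (gam e)} = pos ` e"
  using plane by (simp add: plane_graph_def)

lemma vertex_on_edge: "e \<in> E \<Longrightarrow> v \<in> V \<Longrightarrow> pos v \<in> path_image (gam e) \<Longrightarrow> v \<in> e"
  using plane by (simp add: plane_graph_def)

lemma edges_meet:
  "e \<in> E \<Longrightarrow> e' \<in> E \<Longrightarrow> e \<noteq> e' \<Longrightarrow> path_image (gam e) \<inter> path_image (gam e') \<subseteq> pos ` (e \<inter> e')"
  using plane by (simp add: plane_graph_def)

lemma pos_eq: "u \<in> V \<Longrightarrow> v \<in> V \<Longrightarrow> pos u = pos v \<longleftrightarrow> u = v"
  using inj by (simp add: inj_on_eq_iff)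

lemma finE: "finite E"
  using edge finV by (intro finite_subset[of E "Pow V"]) auto

lemma end_on_edge: "e \<in> E \<Longrightarrow> v \<in> e \<Longrightarrow> pos v \<in> path_image (gam e)"
  using ends[of e] by (metis imageI insertE pathfinish_in_path_image pathstart_in_path_image singletonD)

lemma compact_D: "A \<subseteq> E \<Longrightarrow> compact (D A)"
  using finE arcs by (intro compact_UN) (auto intro: finite_subset compact_arc_image)

lemma compact_KD: "A \<subseteq> E \<Longrightarrow> W \<subseteq> V \<Longrightarrow> compact (pos ` W \<union> D A)"
  by (intro compact_Un compact_D finite_imp_compact finite_imageI finite_subset[OF _ finV])

lemma D_inter:
  assumes "A \<subseteq> E" "B \<subseteq> E" "A \<inter> B = {}" "x \<in> D A" "x \<in> D B"
  shows "\<exists>v\<in>V. x = pos v \<and> (\<exists>e\<in>A. v \<in> e) \<and> (\<exists>f\<in>B. v \<in> f)"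
proof -
  obtain e f where ef: "e \<in> A" "f \<in> B" "x \<in> path_image (gam e)" "x \<in> path_image (gam f)"
    using assms by blast
  moreover have "e \<noteq> f" using ef assms(3) by blast
  ultimately have "x \<in> pos ` (e \<inter> f)" using edges_meet[of e f] assms(1,2) by blast
  then show ?thesis using ef assms(1) edge by blast
qed

lemma vertex_in_D: "A \<subseteq> E \<Longrightarrow> v \<in> V \<Longrightarrow> pos v \<in> D A \<longleftrightarrow> (\<exists>e\<in>A. v \<in> e)"
  using vertex_on_edge end_on_edge by blast

lemma drawing_eq: "drawing V E pos gam = pos ` V \<union> D E"
  by (simp add: drawing_def)

definition open_edge where "open_edge e = path_image (gam e) - pos ` e"

lemma open_edge_eq: "e \<in> E \<Longrightarrow> open_edge e = gam e ` {0<..<1}"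
  using simple_path_endless[OF arc_imp_simple_path[OF arcs[of e]]] ends[of e]
  by (simp add: open_edge_def)

lemma open_edge:
  assumes e: "e \<in> E"
  shows "connected (open_edge e)" "open_edge e \<noteq> {}" "v \<in> e \<Longrightarrow> pos v \<in> closure (open_edge e)"
    "open_edge e \<inter> pos ` V = {}" "A \<subseteq> E \<Longrightarrow> e \<notin> A \<Longrightarrow> open_edge e \<inter> D A = {}"
proof -
  show "connected (open_edge e)" "open_edge e \<noteq> {}"
    using connected_simple_path_endless[OF arc_imp_simple_path[OF arcs[OF e]]] ends[OF e]
      nonempty_simple_path_endless[OF arc_imp_simple_path[OF arcs[OF e]]]
    by (simp_all add: open_edge_def)
  show "pos v \<in> closure (open_edge e)" if "v \<in> e"
  proof -
    have "continuous_on {0..1} (gam e)" using arcs[OF e] by (simp add: arc_def path_def)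
    then have "gam e ` closure {0<..<1} \<subseteq> closure (gam e ` {0<..<1})"
      by (intro image_closure_subset) (auto simp: closure_subset)
    then have "path_image (gam e) \<subseteq> closure (open_edge e)"
      by (simp add: open_edge_eq[OF e] path_image_def)
    then show ?thesis using end_on_edge[OF e that] by blast
  qed
  show "open_edge e \<inter> pos ` V = {}"
    using vertex_on_edge[OF e] by (auto simp: open_edge_def)
  show "open_edge e \<inter> D A = {}" if "A \<subseteq> E" "e \<notin> A"
  proof -
    have "x \<notin> path_image (gam f)" if "x \<in> open_edge e" "f \<in> A" for x f
      using edges_meet[OF e, of f] that \<open>A \<subseteq> E\<close> \<open>e \<notin> A\<close> by (auto simp: open_edge_def)
    then show ?thesis by blast
  qed
qed

lemma path_arc:
  assumes "length xs \<ge> 2" "distinct xs" "path_edges xs \<subseteq> E"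
  shows "\<exists>c. arc c \<and> pathstart c = pos (hd xs) \<and> pathfinish c = pos (last xs) \<and> path_image c = D (path_edges xs)"
  using assms
proof (induction xs)
  case (Cons x ys)
  then obtain y zs where ys: "ys = y # zs" by (cases ys) auto
  have e: "{x, y} \<in> E" using Cons.prems ys by simp
  have xyV: "x \<in> V" "y \<in> V" "x \<noteq> y" using edge[OF e] Cons.prems ys by auto
  obtain c1 where c1: "arc c1" "pathstart c1 = pos x" "pathfinish c1 = pos y" "path_image c1 = path_image (gam {x, y})"
  proof -
    consider "pathstart (gam {x, y}) = pos x" "pathfinish (gam {x, y}) = pos y"
      | "pathstart (gam {x, y}) = pos y" "pathfinish (gam {x, y}) = pos x"
      using ends[OF e] by (auto simp: doubleton_eq_iff)
    then show thesis
      by cases (use that[of "gam {x, y}"] that[of "reversepath (gam {x, y})"] arcs[OF e] in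
          \<open>auto simp: arc_reversepath\<close>)
  qed
  show ?case
  proof (cases "zs = []")
    case True
    then show ?thesis using c1 ys by auto
  next
    case False
    then obtain c2 where c2: "arc c2" "pathstart c2 = pos y" "pathfinish c2 = pos (last ys)"
      "path_image c2 = D (path_edges ys)"
      using Cons ys by (cases zs) auto
    have xn: "x \<notin> f" if "f \<in> path_edges ys" for f
      using path_edges_vertices[OF that] Cons.prems by auto
    have "path_image c1 \<inter> path_image c2 \<subseteq> {pos y}"
    proof
      fix z assume z: "z \<in> path_image c1 \<inter> path_image c2"
      have "{{x, y}} \<inter> path_edges ys = {}" using xn by auto
      moreover have "z \<in> D {{x, y}}" "z \<in> D (path_edges ys)" using z c1 c2 by auto
      moreover have "{{x, y}} \<subseteq> E" "path_edges ys \<subseteq> E" using e Cons.prems ys by auto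
      ultimately obtain v f where "z = pos v" "v \<in> {x, y}" "v \<in> f" "f \<in> path_edges ys"
        using D_inter[of "{{x, y}}" "path_edges ys" z] by auto
      then show "z \<in> {pos y}" using xn by auto
    qed
    then have "arc (c1 +++ c2)" by (intro arc_join c1 c2) (use c1 c2 in auto)
    moreover have "path_image (c1 +++ c2) = D (path_edges (x # ys))"
      using c1 c2 ys by (simp add: path_image_join)
    ultimately show ?thesis using c1 c2 ys by (intro exI[of _ "c1 +++ c2"]) auto
  qed
qed simp

abbreviation DP where "DP a Q b \<equiv> D (path_edges (a # Q @ [b]))"

lemma path_edge_meets_interior:
  assumes "e \<in> path_edges (a # Q @ [b])" "Q \<noteq> []"
  shows "e \<inter> set Q \<noteq> {}"
proof -
  consider "e \<in> path_edges Q" | "e = {a, hd Q}" | "e = {last Q, b}"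
    using assms by (auto simp: pe)
  then show ?thesis
  proof cases
    case 1
    then show ?thesis by (auto simp: path_edges_decomp)
  qed (use assms(2) in auto)
qed

text \<open>\<open>Q1\<close> is nonempty to keep the two edge sets disjoint; \<open>Q2\<close> may
  be empty, which admits the edge from \<open>a\<close> to \<open>b\<close> as the second
  path.\<close>

lemma paths_meet:
  assumes d: "distinct (a # b # Q1 @ Q2)" and Q: "Q1 \<noteq> []"
    and p: "path_edges (a # Q1 @ [b]) \<subseteq> E" "path_edges (a # Q2 @ [b]) \<subseteq> E"
  shows "DP a Q1 b \<inter> DP a Q2 b = {pos a, pos b}"
proof
  have v: "e \<subseteq> insert a (insert b (set Q))" if "e \<in> path_edges (a # Q @ [b])" for e Q
    using path_edges_vertices[OF that] by auto
  have dis: "path_edges (a # Q1 @ [b]) \<inter> path_edges (a # Q2 @ [b]) = {}"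
    using v path_edge_meets_interior[OF _ Q] d by fastforce
  show "DP a Q1 b \<inter> DP a Q2 b \<subseteq> {pos a, pos b}"
  proof
    fix x assume x: "x \<in> DP a Q1 b \<inter> DP a Q2 b"
    obtain w e f where w: "x = pos w" "w \<in> e" "w \<in> f" "e \<in> path_edges (a # Q1 @ [b])" "f \<in> path_edges (a # Q2 @ [b])"
      using D_inter[OF p dis, of x] x by (metis IntD1 IntD2)
    then have "w \<in> {a, b}" using v[of e Q1] v[of f Q2] d by auto
    then show "x \<in> {pos a, pos b}" using w(1) by blast
  qed
  have ab: "\<exists>e\<in>path_edges (a # Q @ [b]). a \<in> e" "\<exists>e\<in>path_edges (a # Q @ [b]). b \<in> e" for Q
    by (auto simp: pe)
  have "a \<in> V" "b \<in> V" using ab[of Q1] p(1) edge by blast+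
  then show "{pos a, pos b} \<subseteq> DP a Q1 b \<inter> DP a Q2 b"
    using ab[of Q1] ab[of Q2] vertex_in_D p by simp
qed

lemma path_vertices_V:
  assumes "path_edges (a # Q @ [b]) \<subseteq> E"
  shows "set (a # Q @ [b]) \<subseteq> V"
proof
  fix x assume "x \<in> set (a # Q @ [b])"
  then obtain e where "e \<in> path_edges (a # Q @ [b])" "x \<in> e"
    using path_edges_cover[of "a # Q @ [b]" x] by auto
  then show "x \<in> V" using assms edge by blast
qed

lemma path_interior_vertex:
  assumes "distinct (a # Q @ [b])" and p: "path_edges (a # Q @ [b]) \<subseteq> E" and x: "x \<in> set Q"
  shows "pos x \<in> DP a Q b - {pos a, pos b}"
proof -
  note V = path_vertices_V[OF p]
  have "\<exists>e\<in>path_edges (a # Q @ [b]). x \<in> e" using x by (intro path_edges_cover) auto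
  then have "pos x \<in> DP a Q b" using vertex_in_D[OF p, of x] V x by auto
  then show ?thesis using assms V pos_eq by auto
qed

lemma three_paths:
  assumes d: "distinct (a # b # Q1 @ Q2 @ Q3)" and Q: "Q1 \<noteq> []" "Q2 \<noteq> []"
    and p: "path_edges (a # Q1 @ [b]) \<subseteq> E" "path_edges (a # Q2 @ [b]) \<subseteq> E" "path_edges (a # Q3 @ [b]) \<subseteq> E"
    and c: "arc c1" "pathstart c1 = pos a" "pathfinish c1 = pos b" "path_image c1 = DP a Q1 b"
      "arc c2" "pathstart c2 = pos a" "pathfinish c2 = pos b" "path_image c2 = DP a Q2 b"
      "arc c3" "pathstart c3 = pos a" "pathfinish c3 = pos b" "path_image c3 = DP a Q3 b"
  shows "three_arcs c1 c2 c3 (pos a) (pos b)"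
proof
  show "path_image c1 \<inter> path_image c2 = {pos a, pos b}"
    unfolding c by (rule paths_meet) (use assms in auto)
  show "path_image c1 \<inter> path_image c3 = {pos a, pos b}"
    unfolding c by (rule paths_meet) (use assms in auto)
  show "path_image c2 \<inter> path_image c3 = {pos a, pos b}"
    unfolding c by (rule paths_meet) (use assms in auto)
qed (use c in auto)

lemma path_arc_between:
  assumes "distinct (a # Q @ [b])" "path_edges (a # Q @ [b]) \<subseteq> E"
  obtains c where "arc c" "pathstart c = pos a" "pathfinish c = pos b" "path_image c = DP a Q b"
  using path_arc[of "a # Q @ [b]"] assms by (auto simp del: path_edges_simps)

lemma theta_region_paths:
  assumes d: "distinct (a # b # Q1 @ Q2 @ Q3)" and Q: "Q1 \<noteq> []" "Q2 \<noteq> []"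
    and p: "path_edges (a # Q1 @ [b]) \<subseteq> E" "path_edges (a # Q2 @ [b]) \<subseteq> E" "path_edges (a # Q3 @ [b]) \<subseteq> E"
    and X: "connected X" "X \<inter> D (theta_edges a b Q1 Q2 Q3) = {}"
    and x: "x1 \<in> set Q1" "x2 \<in> set Q2" "q \<in> DP a Q3 b - {pos a, pos b}"
    and cl: "pos x1 \<in> closure X" "pos x2 \<in> closure X" "q \<in> closure X"
  shows False
proof -
  have d': "distinct (a # Q1 @ [b])" "distinct (a # Q2 @ [b])" "distinct (a # Q3 @ [b])" using d by auto
  obtain c1 where c1: "arc c1" "pathstart c1 = pos a" "pathfinish c1 = pos b" "path_image c1 = DP a Q1 b"
    using path_arc_between[OF d'(1) p(1)] .
  obtain c2 where c2: "arc c2" "pathstart c2 = pos a" "pathfinish c2 = pos b" "path_image c2 = DP a Q2 b"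
    using path_arc_between[OF d'(2) p(2)] .
  obtain c3 where c3: "arc c3" "pathstart c3 = pos a" "pathfinish c3 = pos b" "path_image c3 = DP a Q3 b"
    using path_arc_between[OF d'(3) p(3)] .
  interpret three_arcs c1 c2 c3 "pos a" "pos b" by (rule three_paths[OF d Q p c1 c2 c3])
  have "X \<inter> \<Theta> = {}" using X(2) unfolding c1 c2 c3 by blast
  then show False
    using theta_region[OF X(1) _ _ _ _ cl] path_interior_vertex[OF d'(1) p(1) x(1)]
      path_interior_vertex[OF d'(2) p(2) x(2)] x(3) c1 c2 c3 by simp
qed

text \<open>The chord is the third arc, a path without internal vertices, and the other two arcs are
  those into which \<open>a\<close> and \<open>b\<close> divide the cycle.\<close>

lemma chord_separates_cycle:
  assumes d: "distinct (a # p @ b # q)" and ne: "p \<noteq> []" "q \<noteq> []"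
    and E: "cycle_edges (a # p @ b # q) \<subseteq> E" "{a, b} \<in> E"
    and S: "S \<in> components (- D (cycle_edges (a # p @ b # q)))" "open_edge {a, b} \<subseteq> S"
    and X: "connected X" "X \<subseteq> S" "X \<inter> D {{a, b}} = {}"
    and xy: "x \<in> set p" "y \<in> set q" "pos x \<in> closure X" "pos y \<in> closure X"
  shows False
proof -
  have e: "path_edges (a # p @ [b]) \<subseteq> E" "path_edges (a # rev q @ [b]) \<subseteq> E" "path_edges (a # [] @ [b]) \<subseteq> E"
    using E by (auto simp: cycle_edges_two_arcs)
  have d': "distinct (a # b # p @ rev q @ [])" "distinct (a # p @ [b])" "distinct (a # rev q @ [b])"
    "distinct (a # [] @ [b])" using d by auto
  obtain c1 where c1: "arc c1" "pathstart c1 = pos a" "pathfinish c1 = pos b" "path_image c1 = DP a p b"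
    using path_arc_between[OF d'(2) e(1)] .
  obtain c2 where c2: "arc c2" "pathstart c2 = pos a" "pathfinish c2 = pos b" "path_image c2 = DP a (rev q) b"
    using path_arc_between[OF d'(3) e(2)] .
  obtain c3 where c3: "arc c3" "pathstart c3 = pos a" "pathfinish c3 = pos b" "path_image c3 = DP a [] b"
    using path_arc_between[OF d'(4) e(3)] .
  interpret three_arcs c1 c2 c3 "pos a" "pos b"
    by (rule three_paths[OF d'(1) _ _ e c1 c2 c3]) (use ne in auto)
  have D: "D (cycle_edges (a # p @ b # q)) = path_image c1 \<union> path_image c2"
    unfolding cycle_edges_two_arcs c1 c2 by blast
  show False
    by (rule chord_separates[of S X "pos x" "pos y"])
      (use S X xy path_interior_vertex[OF d'(2) e(1) xy(1)] path_interior_vertex[OF d'(3) e(2), of y] in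
        \<open>auto simp: D c1(4) c2(4) c3(4) open_edge_def\<close>)
qed

lemma cycle_two_sides:
  assumes d: "distinct (a # p @ b # q)" "p \<noteq> []" and E: "cycle_edges (a # p @ b # q) \<subseteq> E"
    and S: "S1 \<in> components (- D (cycle_edges (a # p @ b # q)))" "S2 \<in> components (- D (cycle_edges (a # p @ b # q)))"
      "S \<in> components (- D (cycle_edges (a # p @ b # q)))" "S1 \<noteq> S2"
  shows "S = S1 \<or> S = S2"
proof -
  have e: "path_edges (a # p @ [b]) \<subseteq> E" "path_edges (a # rev q @ [b]) \<subseteq> E"
    using E by (auto simp: cycle_edges_two_arcs)
  have d': "distinct (a # b # p @ rev q)" "distinct (a # p @ [b])" "distinct (a # rev q @ [b])"
    using d by auto
  obtain c1 where c1: "arc c1" "pathstart c1 = pos a" "pathfinish c1 = pos b" "path_image c1 = DP a p b"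
    using path_arc_between[OF d'(2) e(1)] .
  obtain c2 where c2: "arc c2" "pathstart c2 = pos a" "pathfinish c2 = pos b" "path_image c2 = DP a (rev q) b"
    using path_arc_between[OF d'(3) e(2)] .
  interpret two_arcs c1 c2 "pos a" "pos b"
    by unfold_locales (use c1 c2 paths_meet[OF d'(1) d(2) e] in auto)
  have D: "D (cycle_edges (a # p @ b # q)) = path_image c1 \<union> path_image c2"
    unfolding cycle_edges_two_arcs c1 c2 by blast
  show ?thesis using three_components[of S1 S2 S] S unfolding D by blast
qed

section \<open>Separation by cycles\<close>

text \<open>Induction on the edges. Suppose \<open>x\<close> and \<open>y\<close> are no longer
  separated once \<open>e\<close> is removed. If the ends of \<open>e\<close> are still joined by a
  path, \<open>e\<close> closes it to a cycle, which meets the rest exactly in that path; by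
  Janiszewski's theorem this cycle must separate. If not, \<open>e\<close> joins two disjoint parts
  and meets each in one point, and Janiszewski's theorem, applied twice, shows that nothing was
  separated at all.\<close>

lemma separating_cycle:
  assumes "E' \<subseteq> E" "V' \<subseteq> V" "\<Union>E' \<subseteq> V'" "x \<notin> pos ` V' \<union> D E'" "y \<notin> pos ` V' \<union> D E'"
    and "\<not> connected_component (- (pos ` V' \<union> D E')) x y"
  shows "\<exists>Z. is_cycle E' Z \<and> \<not> connected_component (- D (cycle_edges Z)) x y"
proof -
  have "finite E'" using assms(1) finE finite_subset by blast
  then show ?thesis using assms
  proof (induction E' rule: finite_psubset_induct)
    case (psubset E')
    note E' = psubset.prems(1) and V' = psubset.prems(2,3)
    show ?case
    proof (cases "E' = {}")
      case True
      have "finite (pos ` V')" using V'(1) finV finite_subset by blast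
      then have "connected (- (pos ` V' \<union> D E'))"
        using True path_connected_complement_countable[of "pos ` V'"]
        by (simp add: countable_finite path_connected_imp_connected)
      then have "connected_component (- (pos ` V' \<union> D E')) x y"
        by (rule connected_componentI[OF _ order_refl]) (use psubset.prems in auto)
      then show ?thesis using psubset.prems by blast
    next
      case False
      then obtain e where e: "e \<in> E'" by blast
      define E'' where "E'' = E' - {e}"
      have eE: "e \<in> E" and E'': "E'' \<subset> E'" "E'' \<subseteq> E" "\<Union>E'' \<subseteq> V'" "e \<notin> E''" "E' = insert e E''"
        using e E' V' by (auto simp: E''_def)
      obtain u v where uv: "e = {u, v}" "u \<noteq> v" using edge[OF eE] by (auto simp: card_2_iff)
      have uvV: "u \<in> V'" "v \<in> V'" "u \<in> V" "v \<in> V" using uv e V' by auto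
      let ?K = "pos ` V' \<union> D E''"
      show ?thesis
      proof (cases "connected_component (- ?K) x y")
        case False
        then have "\<exists>Z. is_cycle E'' Z \<and> \<not> connected_component (- D (cycle_edges Z)) x y"
          using psubset.IH[OF E''(1) E''(2) V'(1) E''(3)] psubset.prems(4,5) E''(1) by blast
        then show ?thesis using E''(1) unfolding is_cycle_def by blast
      next
        case conn: True
        have e_meet: "z \<in> pos ` e" if "z \<in> path_image (gam e)" "z \<in> ?K" for z
          using that(2)
        proof
          assume "z \<in> pos ` V'"
          then show ?thesis using vertex_on_edge[OF eE] that(1) V'(1) by blast
        next
          assume "z \<in> D E''"
          moreover have "{e} \<inter> E'' = {}" "{e} \<subseteq> E" using E'' eE by auto
          ultimately show ?thesis
            using D_inter[of "{e}" E'' z] E''(2) that(1) by auto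
        qed
        have Ku: "D E' = path_image (gam e) \<union> D E''" using E'' by blast
        show ?thesis
        proof (cases "(adj E'' V')\<^sup>*\<^sup>* u v")
          case True
          then obtain p where p: "p \<noteq> []" "hd p = u" "last p = v" "distinct p" "set p \<subseteq> V'" "path_edges p \<subseteq> E''"
            using adj_reach_path uvV(1) by metis
          obtain p' where p'1: "p = u # p'" using p(1,2) by (cases p) auto
          have "p' \<noteq> []" using p(3) p'1 uv(2) by auto
          note p' = p'1 this
          \<comment> \<open>A path of two vertices would be the edge \<open>e\<close> itself, which
            has been removed.\<close>
          have len: "length p \<ge> 3"
          proof -
            have False if "p' = [v]" using that p p' E''(4) uv by simp
            moreover have "p' = [v]" if "length p' = 1" using that p(3) p' by (cases p') auto
            ultimately have "length p' \<noteq> 1" "length p' \<noteq> 0" using p'(2) by auto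
            then show ?thesis unfolding p'(1) by (simp; linarith)
          qed
          have ce: "cycle_edges p = insert e (path_edges p)"
            using p(1-3) uv by (simp add: cycle_edges_eq insert_commute)
          have Z: "is_cycle E' p" using len p ce E'' by (auto simp: is_cycle_def)
          have pE: "path_edges p \<subseteq> E" using p E'' by blast
          obtain c where c: "arc c" "path_image c = D (path_edges p)"
            using path_arc[of p] len p(4) pE by auto
          have "u \<in> set p" "v \<in> set p" using p(1-3) by auto
          then have uvp: "\<exists>f\<in>path_edges p. u \<in> f" "\<exists>f\<in>path_edges p. v \<in> f"
            using path_edges_cover[of p] len by simp_all
          then have uvD: "pos ` e \<subseteq> D (path_edges p)"
            using vertex_in_D[OF pE uvV(3)] vertex_in_D[OF pE uvV(4)] uv by auto
          have int: "D (cycle_edges p) \<inter> ?K = D (path_edges p)"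
          proof
            show "D (cycle_edges p) \<inter> ?K \<subseteq> D (path_edges p)"
              using e_meet uvD unfolding ce by blast
            show "D (path_edges p) \<subseteq> D (cycle_edges p) \<inter> ?K" using p(6) unfolding ce by blast
          qed
          have un: "D (cycle_edges p) \<union> ?K = pos ` V' \<union> D E'"
            unfolding ce Ku using p(6) by blast
          have "\<not> connected_component (- D (cycle_edges p)) x y"
          proof
            assume cc: "connected_component (- D (cycle_edges p)) x y"
            have "connected_component (- (D (cycle_edges p) \<union> ?K)) x y"
            proof (rule Janiszewski[OF _ _ _ cc conn])
              show "compact (D (cycle_edges p))" using compact_D Z E' unfolding is_cycle_def by blast
              show "closed ?K" using compact_KD[OF E''(2) V'(1)] compact_imp_closed by blast
              show "connected (D (cycle_edges p) \<inter> ?K)"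
                unfolding int using connected_arc_image[OF c(1)] c(2) by simp
            qed
            then show False using psubset.prems(6) unfolding un by blast
          qed
          then show ?thesis using Z by blast
        next
          case False
          \<comment> \<open>Without \<open>e\<close> no edge joins \<open>A\<close> to the remaining
            vertices, so the drawing falls apart into \<open>?KA\<close> and
            \<open>?KB\<close>.\<close>
          define A where "A = {t. (adj E'' V')\<^sup>*\<^sup>* u t}"
          have A: "u \<in> A" "v \<notin> A" "A \<subseteq> V'"
            using False adj_reach_in[of E'' V' u] uvV by (auto simp: A_def)
          have closed: "t \<in> A" if "s \<in> A" "f \<in> E''" "s \<in> f" "t \<in> f" for s t f
          proof (cases "s = t")
            case False
            have "card f = 2" using that(2) E''(2) edge by blast
            then have "f = {s, t}" using that(3,4) False by (auto simp: card_2_iff)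
            then have "adj E'' V' s t" using that E''(3) by (auto simp: adj_def)
            then show ?thesis using that(1) by (auto simp: A_def intro: rtranclp.rtrancl_into_rtrancl)
          qed (use that in simp)
          define EA where "EA = {f \<in> E''. f \<inter> A \<noteq> {}}"
          define EB where "EB = {f \<in> E''. f \<inter> A = {}}"
          let ?KA = "pos ` A \<union> D EA" and ?KB = "pos ` (V' - A) \<union> D EB"
          have EA: "EA \<subseteq> E''" "\<And>f. f \<in> EA \<Longrightarrow> f \<subseteq> A" and EB: "EB \<subseteq> E''" "\<And>f. f \<in> EB \<Longrightarrow> f \<inter> A = {}"
            and EAB: "E'' = EA \<union> EB" "EA \<inter> EB = {}"
            using closed by (auto simp: EA_def EB_def)
          have AV: "A \<subseteq> V" "V' - A \<subseteq> V" "EA \<subseteq> E" "EB \<subseteq> E" using A(3) V'(1) EA EB E'' by auto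
          have sub: "?K = ?KA \<union> ?KB" using EAB(1) A(3) by blast
          have c1: "connected_component (- ?KA) x y"
            by (rule connected_component_of_subset[OF conn]) (use sub in blast)
          have c2: "connected_component (- ?KB) x y"
            by (rule connected_component_of_subset[OF conn]) (use sub in blast)
          have inKA: "w \<in> A" if "pos w \<in> ?KA" "w \<in> V" for w
          proof -
            have "pos w \<in> pos ` A \<Longrightarrow> w \<in> A" using pos_eq that(2) AV(1) by blast
            then show ?thesis using that vertex_in_D[OF AV(3) that(2)] EA(2) by blast
          qed
          have inKB: "w \<notin> A" if "pos w \<in> ?KB" "w \<in> V" for w
          proof -
            have "pos w \<in> pos ` (V' - A) \<Longrightarrow> w \<notin> A" using pos_eq that(2) AV(2) by blast
            then show ?thesis using that vertex_in_D[OF AV(4) that(2)] EB(2) by blast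
          qed
          have disj: "?KA \<inter> ?KB = {}"
          proof (rule ccontr)
            assume "?KA \<inter> ?KB \<noteq> {}"
            then obtain z where z: "z \<in> ?KA" "z \<in> ?KB" by blast
            have "\<exists>w\<in>V. z = pos w"
            proof (cases "z \<in> D EA \<and> z \<in> D EB")
              case True
              then show ?thesis using D_inter[OF AV(3,4) EAB(2), of z] by metis
            next
              case False
              then show ?thesis using z AV by blast
            qed
            then show False using z inKA inKB by blast
          qed
          let ?e = "path_image (gam e)"
          have eu: "?e \<inter> ?KA = {pos u}"
          proof
            show "?e \<inter> ?KA \<subseteq> {pos u}"
            proof
              fix z assume z: "z \<in> ?e \<inter> ?KA"
              then have "z \<in> {pos u, pos v}" using e_meet[of z] sub uv by auto
              then show "z \<in> {pos u}" using inKA[of v] uvV A z by auto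
            qed
          qed (use A end_on_edge[OF eE] uv in auto)
          have ev: "?e \<inter> ?KB = {pos v}"
          proof
            show "?e \<inter> ?KB \<subseteq> {pos v}"
            proof
              fix z assume z: "z \<in> ?e \<inter> ?KB"
              then have "z \<in> {pos u, pos v}" using e_meet[of z] sub uv by auto
              then show "z \<in> {pos v}" using inKB[of u] uvV A z by auto
            qed
          qed (use A uvV end_on_edge[OF eE] uv in auto)
          have "connected (- ?e)" using connected_arc_complement[OF arcs[OF eE]] by simp
          then have c3: "connected_component (- ?e) x y"
            by (rule connected_componentI[OF _ order_refl]) (use psubset.prems(4,5) Ku in auto)
          \<comment> \<open>The edge meets \<open>?KA\<close> only in \<open>pos u\<close>, and
            together with \<open>?KA\<close> it meets \<open>?KB\<close> only in
            \<open>pos v\<close>.\<close>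
          have c4: "connected_component (- (?e \<union> ?KA)) x y"
          proof (rule Janiszewski[OF _ _ _ c3 c1])
            show "compact ?e" using compact_arc_image[OF arcs[OF eE]] .
            show "closed ?KA" using compact_KD[OF AV(3,1)] compact_imp_closed by blast
            show "connected (?e \<inter> ?KA)" unfolding eu by simp
          qed
          have "connected_component (- ((?e \<union> ?KA) \<union> ?KB)) x y"
          proof (rule Janiszewski[OF _ _ _ c4 c2])
            show "compact (?e \<union> ?KA)"
              using compact_arc_image[OF arcs[OF eE]] compact_KD[OF AV(3,1)] by (rule compact_Un)
            show "closed ?KB" using compact_KD[OF AV(4,2)] compact_imp_closed by blast
            have "(?e \<union> ?KA) \<inter> ?KB = {pos v}" using ev disj by blast
            then show "connected ((?e \<union> ?KA) \<inter> ?KB)" by simp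
          qed
          moreover have "(?e \<union> ?KA) \<union> ?KB = ?e \<union> ?K" unfolding sub by (simp add: Un_ac)
          moreover have "?e \<union> ?K = pos ` V' \<union> D E'" unfolding Ku by (simp add: Un_ac)
          ultimately show ?thesis using psubset.prems(6) by simp
        qed
      qed
    qed
  qed
qed

end

section \<open>Facially complete drawings\<close>

context plane_drawing begin

lemma closed_drawing: "closed (pos ` V \<union> D E)"
  using compact_KD[of E V] compact_imp_closed by blast

lemma face_props:
  assumes "F \<in> faces V E pos gam"
  shows "F \<in> components (- (pos ` V \<union> D E))" "connected F" "F \<noteq> {}" "F \<inter> pos ` V = {}" "A \<subseteq> E \<Longrightarrow> F \<inter> D A = {}"
    "frontier F \<subseteq> pos ` V \<union> D E"
proof -
  show F: "F \<in> components (- (pos ` V \<union> D E))" using assms unfolding faces_def drawing_eq .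
  show "connected F" "F \<noteq> {}" using in_components_connected[OF F] in_components_nonempty[OF F] by auto
  have "F \<subseteq> - (pos ` V \<union> D E)" using in_components_subset[OF F] .
  then show "F \<inter> pos ` V = {}" "A \<subseteq> E \<Longrightarrow> F \<inter> D A = {}" by blast+
  show "frontier F \<subseteq> pos ` V \<union> D E" using frontier_component_closed[OF closed_drawing F] .
qed

lemma faces_nonempty: "faces V E pos gam \<noteq> {}"
proof -
  have "compact (pos ` V \<union> D E)" using compact_KD by blast
  then have "- (pos ` V \<union> D E) \<noteq> {}"
    by (metis Compl_eq_Diff_UNIV Diff_eq_empty_iff bounded_subset compact_imp_bounded not_bounded_UNIV)
  then show ?thesis unfolding faces_def drawing_eq by simp
qed

text \<open>Delete \<open>v\<close> with its edges. If this opened a way from \<open>pos v\<close>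
  into \<open>F\<close>, it would cross the frontier of \<open>F\<close> inside an edge at
  \<open>v\<close>; a face that touches the interior of an edge touches its ends, so
  \<open>pos v\<close> would lie on the frontier after all. Hence the remaining graph separates
  \<open>v\<close> from \<open>F\<close>, and so does one of its cycles.\<close>

lemma cycle_avoiding_vertex:
  assumes F: "F \<in> faces V E pos gam" and v: "v \<in> V" "pos v \<notin> frontier F"
  obtains Z where "is_cycle E Z" "v \<notin> set Z"
    "\<And>x. x \<in> F \<Longrightarrow> \<not> connected_component (- D (cycle_edges Z)) (pos v) x"
proof -
  define E' where "E' = {e \<in> E. v \<notin> e}"
  define V' where "V' = V - {v}"
  let ?K = "pos ` V' \<union> D E'"
  note Fp = face_props[OF F]
  obtain x0 where x0: "x0 \<in> F" using Fp by blast
  have E': "E' \<subseteq> E" "V' \<subseteq> V" "\<Union>E' \<subseteq> V'" using edge by (auto simp: E'_def V'_def)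
  have FK: "F \<inter> ?K = {}" using Fp(4) Fp(5)[OF E'(1)] E'(2) by blast
  have vF: "pos v \<notin> F" using Fp(4) v(1) by blast
  have vK: "pos v \<notin> ?K"
    using vertex_in_D[OF E'(1) v(1)] pos_eq[OF v(1)] by (auto simp: E'_def V'_def)
  have "\<not> connected_component (- ?K) (pos v) x0"
  proof
    assume "connected_component (- ?K) (pos v) x0"
    then obtain T where T: "connected T" "T \<subseteq> - ?K" "pos v \<in> T" "x0 \<in> T"
      unfolding connected_component_def by blast
    have "T \<inter> F \<noteq> {}" "T - F \<noteq> {}" using T x0 vF by auto
    then obtain p where p: "p \<in> T" "p \<in> frontier F"
      using connected_Int_frontier[OF T(1), of F] by auto
    have "p \<noteq> pos v" "p \<notin> pos ` V'" using p v T(2) by auto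
    then have "p \<notin> pos ` V" using v(1) by (auto simp: V'_def)
    then obtain e where e: "e \<in> E" "p \<in> path_image (gam e)" using Fp(6) p(2) by blast
    have "v \<in> e" using p T(2) e by (auto simp: E'_def)
    then obtain w where w: "e = {v, w}" "v \<noteq> w" using edge[OF e(1)] by (auto simp: card_2_iff doubleton_eq_iff)
    have wV: "w \<in> V" using w edge[OF e(1)] by auto
    let ?K2 = "pos ` V \<union> D (E - {e})"
    \<comment> \<open>The edge is oriented to start at \<open>v\<close>, since
      \<open>region_touching_edge_interior\<close> carries the contact to the start of the
      arc.\<close>
    obtain c where c: "arc c" "pathstart c = pos v" "pathfinish c = pos w" "path_image c = path_image (gam e)"
    proof -
      consider "pathstart (gam e) = pos v" "pathfinish (gam e) = pos w"
        | "pathstart (gam e) = pos w" "pathfinish (gam e) = pos v"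
        using ends[OF e(1)] w by (auto simp: doubleton_eq_iff)
      then show thesis
        by cases (use that[of "gam e"] that[of "reversepath (gam e)"] arcs[OF e(1)] in
            \<open>auto simp: arc_reversepath\<close>)
    qed
    have K2: "?K2 \<union> path_image c = pos ` V \<union> D E" using c(4) e(1) by blast
    have "pos v \<in> closure F"
    proof (rule region_touching_edge_interior[of ?K2 c F p, unfolded c(2,3)])
      show "closed ?K2" using compact_KD[of "E - {e}" V] compact_imp_closed by blast
      show "path_image c \<inter> ?K2 \<subseteq> {pos v, pos w}"
      proof
        fix z assume z: "z \<in> path_image c \<inter> ?K2"
        then have ze: "z \<in> path_image (gam e)" using c(4) by simp
        have "z \<in> pos ` e"
        proof (cases "z \<in> pos ` V")
          case True
          then show ?thesis using vertex_on_edge[OF e(1)] ze by blast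
        next
          case False
          then have "z \<in> D (E - {e})" using z by blast
          moreover have "{e} \<inter> (E - {e}) = {}" "{e} \<subseteq> E" "E - {e} \<subseteq> E" using e by auto
          ultimately show ?thesis using D_inter[of "{e}" "E - {e}" z] ze by auto
        qed
        then show "z \<in> {pos v, pos w}" using w by auto
      qed
      show "F \<in> components (- (?K2 \<union> path_image c))" unfolding K2 using Fp(1) .
      show "p \<in> path_image c - {pos v, pos w}" using e c(4) \<open>p \<notin> pos ` V\<close> v(1) wV by auto
      show "p \<in> closure F" using p(2) by (simp add: frontier_def)
    qed (use c wV in auto)
    then show False using v(2) vF by (simp add: closure_Un_frontier)
  qed
  moreover have "x0 \<notin> ?K" using FK x0 by blast
  ultimately obtain Z where Z: "is_cycle E' Z" "\<not> connected_component (- D (cycle_edges Z)) (pos v) x0"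
    using separating_cycle[OF E' vK] by blast
  have ZE: "is_cycle E Z" "cycle_edges Z \<subseteq> E" using Z(1) E'(1) unfolding is_cycle_def by auto
  have "v \<notin> set Z" using is_cycle_vertices[OF Z(1)] Z(1) unfolding is_cycle_def E'_def by blast
  moreover have "\<not> connected_component (- D (cycle_edges Z)) (pos v) x" if "x \<in> F" for x
  proof
    assume "connected_component (- D (cycle_edges Z)) (pos v) x"
    moreover have "connected_component (- D (cycle_edges Z)) x x0"
      by (rule connected_componentI[OF Fp(2)]) (use Fp(5)[OF ZE(2)] that x0 in auto)
    ultimately show False using Z(2) connected_component_trans by blast
  qed
  ultimately show thesis using that ZE(1) by blast
qed

end

section \<open>Links and thetas in a facially complete drawing\<close>

locale facially_complete_drawing = plane_drawing +
  assumes complete: "facially_complete V E pos gam"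
begin

lemma common_face:
  assumes "u \<in> V" "v \<in> V" "u \<noteq> v" "{u, v} \<notin> E"
  obtains F where "F \<in> faces V E pos gam" "pos u \<in> frontier F" "pos v \<in> frontier F"
proof -
  have "{u, v} \<in> facial_closure_edges V E pos gam"
    using complete assms unfolding facially_complete_def by blast
  then obtain u' v' F where "{u, v} = {u', v'}" "F \<in> faces V E pos gam"
    "pos u' \<in> frontier F" "pos v' \<in> frontier F"
    using assms(4) unfolding facial_closure_edges_def on_face_boundary_def by blast
  then show thesis using that[of F] by (auto simp: doubleton_eq_iff)
qed

text \<open>The link of two vertices is a face touching both, or the open edge joining them.\<close>

lemma link:
  assumes uv: "u \<in> V" "v \<in> V" "u \<noteq> v"
  obtains X where "connected X" "pos u \<in> closure X" "pos v \<in> closure X" "X \<inter> pos ` V = {}"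
    "\<And>A. A \<subseteq> E \<Longrightarrow> {u, v} \<notin> A \<Longrightarrow> X \<inter> D A = {}"
proof (cases "{u, v} \<in> E")
  case True
  show ?thesis
    by (rule that[of "open_edge {u, v}"]) (use open_edge[OF True] in auto)
next
  case False
  then obtain F where F: "F \<in> faces V E pos gam" "pos u \<in> frontier F" "pos v \<in> frontier F"
    using common_face uv by blast
  show ?thesis
    by (rule that[of F]) (use face_props[OF F(1)] F(2,3) in \<open>auto simp: frontier_def\<close>)
qed

text \<open>A vertex \<open>v\<close> off the theta has links to the first internal vertex of each
  path. They avoid the theta, none of whose edges ends at \<open>v\<close>, and glued together at
  \<open>v\<close> they touch all three open paths.\<close>

lemma theta_spanning:
  assumes T: "theta E a b Q1 Q2 Q3"
  shows "set (a # b # Q1 @ Q2 @ Q3) = V"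
proof -
  have t: "Q1 \<noteq> []" "Q2 \<noteq> []" "Q3 \<noteq> []" "distinct (a # b # Q1 @ Q2 @ Q3)"
    "path_edges (a # Q1 @ [b]) \<subseteq> E" "path_edges (a # Q2 @ [b]) \<subseteq> E" "path_edges (a # Q3 @ [b]) \<subseteq> E"
    using T unfolding theta_def by auto
  note V = path_vertices_V[OF t(5)] path_vertices_V[OF t(6)] path_vertices_V[OF t(7)]
  let ?T = "theta_edges a b Q1 Q2 Q3"
  have TE: "?T \<subseteq> E" using t by blast
  have Tv: "f \<subseteq> set (a # b # Q1 @ Q2 @ Q3)" if "f \<in> ?T" for f
    using that path_edges_vertices[of f] by fastforce
  have "v \<in> set (a # b # Q1 @ Q2 @ Q3)" if v: "v \<in> V" for v
  proof (rule ccontr)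
    assume n: "v \<notin> set (a # b # Q1 @ Q2 @ Q3)"
    have x: "hd Q1 \<in> set Q1" "hd Q2 \<in> set Q2" "hd Q3 \<in> set Q3" using t by auto
    have "\<exists>X. connected X \<and> pos v \<in> closure X \<and> pos x \<in> closure X \<and> X \<inter> D ?T = {}"
      if "x \<in> set Q1 \<union> set Q2 \<union> set Q3" for x
    proof -
      have "x \<in> V" "v \<noteq> x" "{v, x} \<notin> ?T" using that V n Tv by auto
      then show ?thesis using link[of v x] v TE by metis
    qed
    then obtain X1 X2 X3 where
      X: "connected X1" "pos v \<in> closure X1" "pos (hd Q1) \<in> closure X1" "X1 \<inter> D ?T = {}"
        "connected X2" "pos v \<in> closure X2" "pos (hd Q2) \<in> closure X2" "X2 \<inter> D ?T = {}"
        "connected X3" "pos v \<in> closure X3" "pos (hd Q3) \<in> closure X3" "X3 \<inter> D ?T = {}"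
      using x by (metis UnI1 UnI2)
    let ?X = "insert (pos v) X1 \<union> (insert (pos v) X2 \<union> insert (pos v) X3)"
    have "connected ?X"
      using X by (intro connected_Un connected_insert_closure) auto
    moreover have "pos v \<notin> D ?T" using vertex_in_D[OF TE v] Tv n by blast
    then have "?X \<inter> D ?T = {}" using X by blast
    moreover have "closure X1 \<subseteq> closure ?X" "closure X2 \<subseteq> closure ?X" "closure X3 \<subseteq> closure ?X"
      by (intro closure_mono; blast)+
    ultimately show False
      using theta_region_paths[OF t(4,1,2,5,6,7), of ?X "hd Q1" "hd Q2" "pos (hd Q3)"] X x
        path_interior_vertex[OF _ t(7) x(3)] t(4) by auto
  qed
  then show ?thesis using V by auto
qed

text \<open>The edge would be a fourth arc between \<open>a\<close> and \<open>b\<close>. The first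
  internal vertices of the three paths are pairwise linked off all four arcs, because an edge
  between two of them belongs to none of the arcs. This is the situation of
  \<open>no_fourth_arc\<close>.\<close>

lemma theta_ends_nonadjacent:
  assumes T: "theta E a b Q1 Q2 Q3"
  shows "{a, b} \<notin> E"
proof
  assume ab: "{a, b} \<in> E"
  have t: "Q1 \<noteq> []" "Q2 \<noteq> []" "Q3 \<noteq> []" "distinct (a # b # Q1 @ Q2 @ Q3)"
    "path_edges (a # Q1 @ [b]) \<subseteq> E" "path_edges (a # Q2 @ [b]) \<subseteq> E" "path_edges (a # Q3 @ [b]) \<subseteq> E"
    using T unfolding theta_def by auto
  have e: "path_edges (a # [] @ [b]) \<subseteq> E" using ab by simp
  note V = path_vertices_V[OF t(5)] path_vertices_V[OF t(6)] path_vertices_V[OF t(7)]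
  let ?T = "insert {a, b} (theta_edges a b Q1 Q2 Q3)"
  have TE: "?T \<subseteq> E" using t ab by blast
  have d: "distinct (a # Q1 @ [b])" "distinct (a # Q2 @ [b])" "distinct (a # Q3 @ [b])" "distinct (a # [] @ [b])"
    using t(4) by auto
  have d3: "distinct (a # b # Q1 @ Q2 @ [])" "distinct (a # b # Q1 @ Q3 @ [])" "distinct (a # b # Q2 @ Q3 @ [])"
    using t(4) by auto
  obtain c1 where c1: "arc c1" "pathstart c1 = pos a" "pathfinish c1 = pos b" "path_image c1 = DP a Q1 b"
    using path_arc_between[OF d(1) t(5)] .
  obtain c2 where c2: "arc c2" "pathstart c2 = pos a" "pathfinish c2 = pos b" "path_image c2 = DP a Q2 b"
    using path_arc_between[OF d(2) t(6)] .
  obtain c3 where c3: "arc c3" "pathstart c3 = pos a" "pathfinish c3 = pos b" "path_image c3 = DP a Q3 b"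
    using path_arc_between[OF d(3) t(7)] .
  obtain c4 where c4: "arc c4" "pathstart c4 = pos a" "pathfinish c4 = pos b" "path_image c4 = DP a [] b"
    using path_arc_between[OF d(4) e] .
  have x: "hd Q1 \<in> set Q1" "hd Q2 \<in> set Q2" "hd Q3 \<in> set Q3" using t by auto
  have Tv: "f \<subseteq> insert a (insert b (set Q1)) \<or> f \<subseteq> insert a (insert b (set Q2)) \<or> f \<subseteq> insert a (insert b (set Q3))"
    if "f \<in> ?T" for f
    using that path_edges_vertices[of f "a # Q1 @ [b]"] path_edges_vertices[of f "a # Q2 @ [b]"]
      path_edges_vertices[of f "a # Q3 @ [b]"] by auto
  have "f \<notin> ?T" if "f = {hd Q1, hd Q2} \<or> f = {hd Q1, hd Q3} \<or> f = {hd Q2, hd Q3}" for f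
  proof
    assume "f \<in> ?T"
    from Tv[OF this] that show False using x t(4) by auto
  qed
  then have n: "{hd Q1, hd Q2} \<notin> ?T" "{hd Q1, hd Q3} \<notin> ?T" "{hd Q2, hd Q3} \<notin> ?T"
    by blast+
  have xV: "hd Q1 \<in> V" "hd Q2 \<in> V" "hd Q3 \<in> V" "hd Q1 \<noteq> hd Q2" "hd Q1 \<noteq> hd Q3" "hd Q2 \<noteq> hd Q3"
    using V x t(4) by auto
  obtain X12 where X12: "connected X12" "pos (hd Q1) \<in> closure X12" "pos (hd Q2) \<in> closure X12" "X12 \<inter> D ?T = {}"
    using link[OF xV(1,2,4)] TE n(1) by metis
  obtain X13 where X13: "connected X13" "pos (hd Q1) \<in> closure X13" "pos (hd Q3) \<in> closure X13" "X13 \<inter> D ?T = {}"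
    using link[OF xV(1,3,5)] TE n(2) by metis
  obtain X23 where X23: "connected X23" "pos (hd Q2) \<in> closure X23" "pos (hd Q3) \<in> closure X23" "X23 \<inter> D ?T = {}"
    using link[OF xV(2,3,6)] TE n(3) by metis
  have D: "D ?T = path_image c1 \<union> path_image c2 \<union> path_image c3 \<union> path_image c4"
    unfolding c1 c2 c3 c4 by auto
  show False
  proof (rule no_fourth_arc[of c1 c2 c4 "pos a" "pos b" c3 "pos (hd Q1)" "pos (hd Q2)" "pos (hd Q3)" X12 X13 X23])
    show "three_arcs c1 c2 c4 (pos a) (pos b)" by (rule three_paths[OF d3(1) t(1,2,5,6) e c1 c2 c4])
    show "three_arcs c1 c3 c4 (pos a) (pos b)" by (rule three_paths[OF d3(2) t(1,3,5,7) e c1 c3 c4])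
    show "three_arcs c2 c3 c4 (pos a) (pos b)" by (rule three_paths[OF d3(3) t(2,3,6,7) e c2 c3 c4])
    show "pos (hd Q1) \<in> path_image c1 - {pos a, pos b}" "pos (hd Q2) \<in> path_image c2 - {pos a, pos b}"
      "pos (hd Q3) \<in> path_image c3 - {pos a, pos b}"
      unfolding c1 c2 c3 using path_interior_vertex[OF d(1) t(5) x(1)] path_interior_vertex[OF d(2) t(6) x(2)]
        path_interior_vertex[OF d(3) t(7) x(3)] by blast+
    show "connected X \<and> X \<inter> (path_image c1 \<union> path_image c2 \<union> path_image c3 \<union> path_image c4) = {}"
      if "X \<in> {X12, X13, X23}" for X
      using that X12(1,4) X13(1,4) X23(1,4) unfolding D by auto
  qed (use X12 X13 X23 in auto)
qed

text \<open>A face carrying every vertex would touch all three open paths of the theta.\<close>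

lemma theta_not_outerplanar:
  assumes T: "theta E a b Q1 Q2 Q3"
  shows "\<not> outerplanar_plane V E pos gam"
proof
  assume "outerplanar_plane V E pos gam"
  then obtain F where F: "F \<in> faces V E pos gam" "\<And>v. v \<in> V \<Longrightarrow> pos v \<in> closure F"
    unfolding outerplanar_plane_def on_face_boundary_def frontier_def by blast
  have t: "Q1 \<noteq> []" "Q2 \<noteq> []" "Q3 \<noteq> []" "distinct (a # b # Q1 @ Q2 @ Q3)"
    "path_edges (a # Q1 @ [b]) \<subseteq> E" "path_edges (a # Q2 @ [b]) \<subseteq> E" "path_edges (a # Q3 @ [b]) \<subseteq> E"
    using T unfolding theta_def by auto
  note V = path_vertices_V[OF t(5)] path_vertices_V[OF t(6)] path_vertices_V[OF t(7)]
  have x: "hd Q1 \<in> set Q1" "hd Q2 \<in> set Q2" "hd Q3 \<in> set Q3" using t by auto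
  have TE: "theta_edges a b Q1 Q2 Q3 \<subseteq> E" using t by blast
  have q: "pos (hd Q3) \<in> DP a Q3 b - {pos a, pos b}"
    by (rule path_interior_vertex) (use t x in auto)
  show False
    by (rule theta_region_paths[OF t(4,1,2,5,6,7) face_props(2)[OF F(1)] face_props(5)[OF F(1) TE] x(1,2) q])
      (use F(2) x V in auto)
qed

lemma wheel_type4:
  assumes "partial_wheel V E" "\<not> outerplanar_plane V E pos gam"
  shows "fc_type4 V E pos gam"
  using assms unfolding partial_wheel_def fc_type4_def by blast

lemma types_if_theta:
  assumes T: "theta E a b Q1 Q2 Q3"
  shows "fc_type1 V E \<or> fc_type2 V E \<or> fc_type3 V E \<or> fc_type4 V E pos gam"
proof -
  interpret spanning_thetas V E
    by unfold_locales (use edge theta_spanning theta_ends_nonadjacent in auto)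
  show ?thesis using theta_classification[OF T] wheel_type4 theta_not_outerplanar[OF T] by blast
qed

text \<open>Take a cycle of the graph without \<open>v\<close> that separates \<open>v\<close> from
  \<open>F\<close>. A vertex of \<open>F\<close> off this cycle would have a link to
  \<open>v\<close> that avoids the cycle, since an edge at \<open>v\<close> is not a cycle edge, and
  the link would join \<open>v\<close> to \<open>F\<close>.\<close>

lemma face_vertices_on_cycle:
  assumes F: "F \<in> faces V E pos gam" and v: "v \<in> V" "pos v \<notin> frontier F"
  obtains C where "is_cycle E C" "\<And>u. u \<in> V \<Longrightarrow> pos u \<in> frontier F \<Longrightarrow> u \<in> set C"
proof -
  obtain C where C: "is_cycle E C" "v \<notin> set C"
    "\<And>x. x \<in> F \<Longrightarrow> \<not> connected_component (- D (cycle_edges C)) (pos v) x"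
    using cycle_avoiding_vertex[OF F v] by blast
  note Fp = face_props[OF F]
  have CE: "cycle_edges C \<subseteq> E" using C(1) by (simp add: is_cycle_def)
  have Cv: "f \<subseteq> set C" if "f \<in> cycle_edges C" for f
    using path_edges_vertices[of f "C @ [hd C]"] that C(1) by (cases C) (auto simp: cycle_edges_def is_cycle_def)
  have "u \<in> set C" if u: "u \<in> V" "pos u \<in> frontier F" for u
  proof (rule ccontr)
    assume n: "u \<notin> set C"
    have "v \<noteq> u" using u v by blast
    then obtain X where X: "connected X" "pos v \<in> closure X" "pos u \<in> closure X"
      "\<And>A. A \<subseteq> E \<Longrightarrow> {v, u} \<notin> A \<Longrightarrow> X \<inter> D A = {}"
      using link[OF v(1) u(1)] by metis
    have "{v, u} \<notin> cycle_edges C" using Cv C(2) by blast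
    then have XD: "X \<inter> D (cycle_edges C) = {}" using X(4)[OF CE] by blast
    have nD: "pos v \<notin> D (cycle_edges C)" "pos u \<notin> D (cycle_edges C)"
      by (metis n C(2) Cv subsetD vertex_in_D[OF CE v(1)], metis n C(2) Cv subsetD vertex_in_D[OF CE u(1)])
    obtain x where x: "x \<in> F" using Fp by blast
    let ?Y = "insert (pos v) (insert (pos u) X) \<union> insert (pos u) F"
    have "closure X \<subseteq> closure (insert (pos u) X)" by (rule closure_mono) blast
    moreover have "pos u \<in> closure F" using u by (simp add: frontier_def)
    ultimately have "connected ?Y"
      using X Fp(2) by (intro connected_Un connected_insert_closure) auto
    moreover have "?Y \<subseteq> - D (cycle_edges C)" using XD nD Fp(5)[OF CE] by blast
    ultimately have "connected_component (- D (cycle_edges C)) (pos v) x"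
      by (rule connected_componentI) (use x in auto)
    then show False using C(3)[OF x] by blast
  qed
  then show thesis using that C(1) by blast
qed

end

section \<open>Facially complete drawings without thetas\<close>

locale theta_free_drawing = facially_complete_drawing + theta_free V E
begin

text \<open>Any face will do, because a vertex missing from it would produce a cycle.\<close>

lemma acyclic_outerplanar:
  assumes "\<And>C. \<not> is_cycle E C"
  shows "outerplanar_plane V E pos gam"
proof -
  obtain F where "F \<in> faces V E pos gam" using faces_nonempty by blast
  then show ?thesis
    using face_vertices_on_cycle assms unfolding outerplanar_plane_def on_face_boundary_def by metis
qed

text \<open>A vertex missing from the common face of \<open>w\<close> and \<open>z\<close> yields a
  cycle through both of them. Then \<open>z\<close> would have a neighbour in the component of
  \<open>w\<close>, against its choice.\<close>

lemma nonspanning_outerplanar: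
  assumes Z: "longest_cycle E Z" and w: "w \<in> V - set Z"
  shows "outerplanar_plane V E pos gam"
proof -
  obtain z where z: "z \<in> set Z" "\<And>b. b \<in> blob Z w \<Longrightarrow> {b, z} \<notin> E"
    using blob_avoids_vertex[OF Z w] by blast
  have zV: "z \<in> V" using z(1) Z is_cycle_in unfolding longest_cycle_def by blast
  have "{w, z} \<notin> E" using z(2) by simp
  then obtain F where F: "F \<in> faces V E pos gam" "pos w \<in> frontier F" "pos z \<in> frontier F"
    using common_face[of w z] w z zV by blast
  have "pos v \<in> frontier F" if v: "v \<in> V" for v
  proof (rule ccontr)
    assume "pos v \<notin> frontier F"
    then obtain C where C: "is_cycle E C" "\<And>u. u \<in> V \<Longrightarrow> pos u \<in> frontier F \<Longrightarrow> u \<in> set C"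
      using face_vertices_on_cycle[OF F(1) v] by blast
    then show False using cycle_through_blob[OF Z C(1), of w z] F w z zV by blast
  qed
  then show ?thesis using F(1) unfolding outerplanar_plane_def on_face_boundary_def by blast
qed

lemma cycle_edges_vertices: "f \<in> cycle_edges (a # p @ b # q) \<Longrightarrow> f \<subseteq> set (a # p @ [b]) \<or> f \<subseteq> set (a # rev q @ [b])"
  using path_edges_vertices[of f "a # p @ [b]"] path_edges_vertices[of f "a # rev q @ [b]"]
  by (auto simp: cycle_edges_two_arcs simp del: path_edges_simps)

lemma component_containing:
  assumes "connected X" "X \<inter> K = {}" "X \<noteq> {}"
  obtains S where "S \<in> components (- K)" "X \<subseteq> S"
  using exists_component_superset[of X "- K"] assms by blast

text \<open>The link between \<open>hd p\<close> and \<open>hd l2\<close> lies on one side of the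
  cycle. On \<open>S1\<close> the chord from \<open>a\<close> to \<open>b\<close> stands between the
  two vertices; on \<open>S2\<close> the chord from \<open>c\<close> to \<open>d\<close> does, since
  \<open>l2\<close> lies strictly between its ends and \<open>p\<close> on the other arc.\<close>

lemma noncrossing_chords:
  assumes Z: "is_cycle E (a # p @ b # q)" and V: "set (a # p @ b # q) = V"
    and e: "{a, b} \<in> E" "{c, d} \<in> E" "{c, d} \<notin> cycle_edges (a # p @ b # q)"
    and ne: "p \<noteq> []" "q \<noteq> []"
    and S: "S1 \<in> components (- D (cycle_edges (a # p @ b # q)))" "S2 \<in> components (- D (cycle_edges (a # p @ b # q)))"
      "S1 \<noteq> S2" "open_edge {a, b} \<subseteq> S1" "open_edge {c, d} \<subseteq> S2"
    and L: "b # q @ [a] = l1 @ c # l2 @ d # l3"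
  shows False
proof -
  let ?Z = "a # p @ b # q"
  have Zd: "distinct ?Z" "cycle_edges ?Z \<subseteq> E" using Z by (auto simp: is_cycle_def)
  have Ld: "distinct (l1 @ c # l2 @ d # l3)" unfolding L[symmetric] using Zd by auto
  \<comment> \<open>The cycle is rotated to start at \<open>c\<close>, so that the second chord
    divides it into \<open>l2\<close> and the rest, which contains \<open>p\<close>.\<close>
  have "cycle_edges ?Z = cycle_edges (b # q @ [a] @ p)"
    using cycle_edges_rotate[of "a # p" "b # q"] by simp
  also have "b # q @ [a] @ p = l1 @ (c # l2 @ d # l3 @ p)" using L by simp
  also have "cycle_edges (l1 @ (c # l2 @ d # l3 @ p)) = cycle_edges (c # l2 @ d # (l3 @ p @ l1))"
    using cycle_edges_rotate[of l1 "c # l2 @ d # l3 @ p"] by simp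
  finally have ce: "cycle_edges ?Z = cycle_edges (c # l2 @ d # (l3 @ p @ l1))" .
  have pL: "set p \<inter> set (l1 @ c # l2 @ d # l3) = {}" unfolding L[symmetric] using Zd by auto
  have d2: "distinct (c # l2 @ d # (l3 @ p @ l1))" using Ld pL Zd by auto
  have l2: "l2 \<noteq> []"
  proof
    assume "l2 = []"
    then have "{c, d} \<in> cycle_edges (c # l2 @ d # (l3 @ p @ l1))"
      unfolding cycle_edges_two_arcs by simp
    then show False using e(3) ce by simp
  qed
  let ?x = "hd p" and ?y = "hd l2"
  have x: "?x \<in> set p" and y: "?y \<in> set l2" using ne l2 by auto
  have yq: "?y \<in> set q"
  proof -
    have "?y \<in> set (b # q @ [a])" unfolding L using y by simp
    moreover have "?y \<noteq> b"
    proof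
      assume "?y = b"
      moreover have "hd (l1 @ c # l2 @ d # l3) = b" by (simp flip: L)
      ultimately show False using Ld y by (cases l1) auto
    qed
    moreover have "?y \<noteq> a"
    proof
      assume "?y = a"
      moreover have "last (l1 @ c # l2 @ d # l3) = a" by (simp flip: L)
      ultimately show False using Ld y by (cases l3 rule: rev_cases) auto
    qed
    ultimately show ?thesis by auto
  qed
  have xy: "?x \<in> V" "?y \<in> V" "?x \<noteq> ?y" using x yq V Zd by auto
  have n1: "{?x, ?y} \<notin> cycle_edges ?Z"
    using cycle_edges_vertices[of "{?x, ?y}" a p b q] x yq Zd(1) by auto
  have n2: "{?x, ?y} \<noteq> {a, b}" using x Zd by (auto simp: doubleton_eq_iff)
  have n3: "{?x, ?y} \<noteq> {c, d}" using y Ld pL x by (auto simp: doubleton_eq_iff)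
  obtain X where X: "connected X" "pos ?x \<in> closure X" "pos ?y \<in> closure X"
    "\<And>A. A \<subseteq> E \<Longrightarrow> {?x, ?y} \<notin> A \<Longrightarrow> X \<inter> D A = {}"
    using link[OF xy] by metis
  have XZ: "X \<inter> D (cycle_edges ?Z) = {}" "X \<inter> D {{a, b}} = {}" "X \<inter> D {{c, d}} = {}"
    using X(4)[OF Zd(2) n1] X(4)[of "{{a, b}}"] X(4)[of "{{c, d}}"] e n2 n3 by blast+
  have "X \<noteq> {}" using X(2) by auto
  then obtain S where SX: "S \<in> components (- D (cycle_edges ?Z))" "X \<subseteq> S"
    using component_containing[OF X(1) XZ(1)] by blast
  have "S = S1 \<or> S = S2"
    using cycle_two_sides[OF Zd(1) ne(1) Zd(2) S(1,2) SX(1) S(3)] .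
  then show False
  proof
    assume "S = S1"
    then show False
      using chord_separates_cycle[OF Zd(1) ne Zd(2) e(1) S(1,4) X(1) _ XZ(2) x yq X(2,3)] SX(2) by blast
  next
    assume S2: "S = S2"
    have "?x \<in> set (l3 @ p @ l1)" using x by simp
    moreover have "l3 @ p @ l1 \<noteq> []" using ne by simp
    ultimately show False
      using chord_separates_cycle[OF d2 l2 _ Zd(2)[unfolded ce] e(2) S(2)[unfolded ce] S(5) X(1) _ XZ(3) y _ X(3,2)]
        SX(2) S2 by blast
  qed
qed

lemma spanning_cycle_types:
  assumes Z: "is_cycle E Z" and V: "set Z = V"
  shows "fc_type5 V E pos gam \<or> fc_type4 V E pos gam"
proof (rule disjCI)
  assume n4: "\<not> fc_type4 V E pos gam"
  have Zd: "length Z \<ge> 3" "distinct Z" "cycle_edges Z \<subseteq> E" using Z by (auto simp: is_cycle_def)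
  show "fc_type5 V E pos gam"
  proof (rule ccontr)
    assume "\<not> fc_type5 V E pos gam"
    then have n5: "\<exists>e\<in>E - cycle_edges Z. \<not> open_edge e \<subseteq> S" if "S \<in> components (- D (cycle_edges Z))" for S
      using Zd V that unfolding fc_type5_def open_edge_def by blast
    have side: "\<exists>S\<in>components (- D (cycle_edges Z)). open_edge e \<subseteq> S" if "e \<in> E - cycle_edges Z" for e
    proof -
      have "e \<in> E" "e \<notin> cycle_edges Z" using that by auto
      then show ?thesis
        using component_containing[of "open_edge e" "D (cycle_edges Z)"] open_edge[of e] Zd(3) by metis
    qed
    have "compact (D (cycle_edges Z))" using compact_D[OF Zd(3)] .
    then have "- D (cycle_edges Z) \<noteq> {}"
      by (metis Compl_eq_Diff_UNIV Diff_eq_empty_iff bounded_subset compact_imp_bounded not_bounded_UNIV)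
    \<comment> \<open>An arbitrary side: failure of type 5 on it provides a first chord, and failure
      on the side of that chord a second one elsewhere.\<close>
    then obtain S0 where "S0 \<in> components (- D (cycle_edges Z))" using components_eq_empty by blast
    then obtain e1 where e1: "e1 \<in> E - cycle_edges Z" using n5 by blast
    then obtain S1 where S1: "S1 \<in> components (- D (cycle_edges Z))" "open_edge e1 \<subseteq> S1" using side by blast
    then obtain e2 where e2: "e2 \<in> E - cycle_edges Z" "\<not> open_edge e2 \<subseteq> S1" using n5 by blast
    then obtain S2 where S2: "S2 \<in> components (- D (cycle_edges Z))" "open_edge e2 \<subseteq> S2" using side by blast
    have S12: "S1 \<noteq> S2" using e2 S2 by blast
    obtain a b where ab: "e1 = {a, b}" "a \<noteq> b" using e1 edge[of e1] by (auto simp: card_2_iff)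
    obtain c d where cd: "e2 = {c, d}" "c \<noteq> d" using e2 edge[of e2] by (auto simp: card_2_iff)
    have abV: "a \<in> set Z" "b \<in> set Z" "c \<in> set Z" "d \<in> set Z" using e1 e2 ab cd edge[of e1] edge[of e2] V by auto
    obtain u v where uv: "Z = u @ a # v" using abV(1) by (meson split_list)
    have "b \<in> set (v @ u)" using abV ab uv by auto
    then obtain p q where pq: "v @ u = p @ b # q" by (meson split_list)
    let ?Z = "a # p @ b # q" and ?Z' = "b # q @ a # p"
    have ce: "cycle_edges Z = cycle_edges ?Z" using cycle_edges_rotate[of u "a # v"] uv pq by simp
    have ce': "cycle_edges Z = cycle_edges ?Z'" using cycle_edges_rotate[of "a # p" "b # q"] ce by simp
    have sZ: "set ?Z = set Z" using uv pq by (metis Un_insert_right insert_is_Un list.simps(15) set_append sup_commute)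
    have Zc: "is_cycle E ?Z" using is_cycle_rotate[of E u "a # v"] Z uv pq by simp
    have Zc': "is_cycle E ?Z'" using is_cycle_rotate[of E "a # p" "b # q"] Zc by simp
    have pne: "p \<noteq> []"
    proof
      assume "p = []"
      then have "e1 \<in> cycle_edges Z" unfolding ce cycle_edges_two_arcs ab by simp
      then show False using e1 by blast
    qed
    have qne: "q \<noteq> []"
    proof
      assume "q = []"
      then have "e1 \<in> cycle_edges Z" unfolding ce cycle_edges_two_arcs ab by simp
      then show False using e1 by blast
    qed
    have E: "{a, b} \<in> E" "{b, a} \<in> E" "{c, d} \<in> E" "{d, c} \<in> E" "{c, d} \<notin> cycle_edges Z" "{d, c} \<notin> cycle_edges Z"
      "open_edge {a, b} \<subseteq> S1" "open_edge {b, a} \<subseteq> S1" "open_edge {c, d} \<subseteq> S2" "open_edge {d, c} \<subseteq> S2"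
      using e1 e2 S1 S2 ab cd by (auto simp: insert_commute)
    have V1: "set ?Z = V" "set ?Z' = V" using sZ V by auto
    have nc: False if "c \<in> set (b # q @ [a])" "d \<in> set (b # q @ [a])"
    proof (rule two_elements_decomp[OF that cd(2)])
      fix l1 l2 l3 assume "b # q @ [a] = l1 @ c # l2 @ d # l3"
      then show False
        by (rule noncrossing_chords[OF Zc V1(1) E(1,3) E(5)[unfolded ce] pne qne
              S1(1)[unfolded ce] S2(1)[unfolded ce] S12 E(7,9)])
    next
      fix l1 l2 l3 assume "b # q @ [a] = l1 @ d # l2 @ c # l3"
      then show False
        by (rule noncrossing_chords[OF Zc V1(1) E(1,4) E(6)[unfolded ce] pne qne
              S1(1)[unfolded ce] S2(1)[unfolded ce] S12 E(7,10)])
    qed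
    have nc': False if "c \<in> set (a # p @ [b])" "d \<in> set (a # p @ [b])"
    proof (rule two_elements_decomp[OF that cd(2)])
      fix l1 l2 l3 assume "a # p @ [b] = l1 @ c # l2 @ d # l3"
      then show False
        by (rule noncrossing_chords[OF Zc' V1(2) E(2,3) E(5)[unfolded ce'] qne pne
              S1(1)[unfolded ce'] S2(1)[unfolded ce'] S12 E(8,9)])
    next
      fix l1 l2 l3 assume "a # p @ [b] = l1 @ d # l2 @ c # l3"
      then show False
        by (rule noncrossing_chords[OF Zc' V1(2) E(2,4) E(6)[unfolded ce'] qne pne
              S1(1)[unfolded ce'] S2(1)[unfolded ce'] S12 E(8,10)])
    qed
    have cross: False if c: "c \<in> set p" and d: "d \<in> set q" and E2: "{c, d} \<in> E" "open_edge {c, d} \<subseteq> S2" for c d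
    proof -
      note K = crossing_chords[OF Zc V1(1) E(1) E2(1) c d]
      \<comment> \<open>K_4 has too few vertices for a theta, so this needs its own argument: a face
        lies on one side of the cycle, and the chord drawn there separates the ends of the other
        chord.\<close>
      have "\<not> outerplanar_plane V E pos gam"
      proof
        assume "outerplanar_plane V E pos gam"
        then obtain F where F: "F \<in> faces V E pos gam" "\<And>v. v \<in> V \<Longrightarrow> pos v \<in> closure F"
          unfolding outerplanar_plane_def on_face_boundary_def frontier_def by blast
        note Fp = face_props[OF F(1)]
        have Zd': "distinct ?Z" "cycle_edges ?Z \<subseteq> E" using Zc by (auto simp: is_cycle_def)
        obtain S where S: "S \<in> components (- D (cycle_edges ?Z))" "F \<subseteq> S"
          using component_containing[OF Fp(2) Fp(5)[OF Zd'(2)] Fp(3)] by blast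
        have Fe: "F \<inter> D {{a, b}} = {}" "F \<inter> D {{c, d}} = {}" using Fp(5) E E2 by blast+
        have VV: "a \<in> V" "b \<in> V" "c \<in> V" "d \<in> V" using V1(1) K by auto
        have "S = S1 \<or> S = S2"
          using cycle_two_sides[OF Zd'(1) pne Zd'(2) S1(1)[unfolded ce] S2(1)[unfolded ce] S(1) S12] .
        then show False
        proof
          assume "S = S1"
          then show False
            using chord_separates_cycle[OF Zd'(1) pne qne Zd'(2) E(1) S1(1)[unfolded ce] E(7) Fp(2) _ Fe(1) c d] S(2) F(2) VV by blast
        next
          assume "S = S2"
          have ce2: "cycle_edges Z = cycle_edges (c # [b] @ d # [a])"
            unfolding ce K(1,2) using cycle_edges_rotate[of "[a]" "[c, b, d]"] by simp
          have "distinct (c # [b] @ d # [a])" using Zd'(1) K(1,2) by auto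
          then show False
            using chord_separates_cycle[of c "[b]" d "[a]" S2 F b a] Zd(3) E2 S2(1) Fp(2) Fe(2) S(2) \<open>S = S2\<close> F(2) VV
            unfolding ce2 by auto
        qed
      qed
      then show False using wheel_type4 K(3) n4 by blast
    qed
    have "c \<in> set ?Z" "d \<in> set ?Z" using abV sZ by auto
    then consider "c \<in> set (b # q @ [a])" "d \<in> set (b # q @ [a])" | "c \<in> set (a # p @ [b])" "d \<in> set (a # p @ [b])"
      | "c \<in> set p" "d \<in> set q" | "d \<in> set p" "c \<in> set q" by auto
    then show False using nc nc' cross[of c d] cross[of d c] E by cases blast+
  qed
qed

text \<open>A single vertex is of type 6 outright, so the connectivity has to be known only from two
  vertices on.\<close>

lemma types_if_outerplanar_not_spanning:
  assumes "outerplanar_plane V E pos gam" "V \<noteq> {}"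
    "graph_connected V E \<Longrightarrow> card V \<ge> 2 \<Longrightarrow> vertex_connectivity V E = 1"
  shows "fc_type6 V E pos gam \<or> fc_type7 V E pos gam"
proof (cases "graph_connected V E")
  case True
  have "card V \<noteq> 0" using assms(2) finV by simp
  then consider "card V = 1" | "card V \<ge> 2" by linarith
  then show ?thesis using assms True unfolding fc_type6_def by cases auto
qed (use assms in \<open>simp add: fc_type7_def\<close>)

lemma types_if_theta_free:
  assumes "V \<noteq> {}"
  shows "fc_type4 V E pos gam \<or> fc_type5 V E pos gam \<or> fc_type6 V E pos gam \<or> fc_type7 V E pos gam"
proof (cases "\<exists>C. is_cycle E C")
  case False
  then show ?thesis
    using types_if_outerplanar_not_spanning[OF acyclic_outerplanar assms] vertex_connectivity_one_if_acyclic by blast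
next
  case True
  then obtain Z where Z: "longest_cycle E Z" using longest_cycle_exists by blast
  then have Zc: "is_cycle E Z" by (simp add: longest_cycle_def)
  show ?thesis
  proof (cases "set Z = V")
    case True
    then show ?thesis using spanning_cycle_types[OF Zc] by blast
  next
    case False
    then obtain w where w: "w \<in> V - set Z" using is_cycle_in[OF Zc] by blast
    then show ?thesis
      using types_if_outerplanar_not_spanning[OF nonspanning_outerplanar[OF Z w] assms]
        vertex_connectivity_one_if_not_spanning[OF Z w] by blast
  qed
qed

end

theorem mainTheorem6:
  fixes V :: "'v set" and E :: "'v set set"
    and pos :: "'v \<Rightarrow> complex" and gam :: "'v set \<Rightarrow> real \<Rightarrow> complex"
  assumes "plane_graph V E pos gam"
    and "V \<noteq> {}"
    and "facially_complete V E pos gam"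
  shows "fc_type1 V E \<or> fc_type2 V E \<or> fc_type3 V E \<or> fc_type4 V E pos gam \<or>
         fc_type5 V E pos gam \<or> fc_type6 V E pos gam \<or> fc_type7 V E pos gam"
proof -
  interpret facially_complete_drawing V E pos gam
    by unfold_locales (use assms in auto)
  show ?thesis
  proof (cases "\<exists>a b Q1 Q2 Q3. theta E a b Q1 Q2 Q3")
    case True
    then show ?thesis using types_if_theta by blast
  next
    case False
    then interpret theta_free_drawing V E pos gam
      by unfold_locales (use finV edge in auto)
    show ?thesis using types_if_theta_free[OF assms(2)] by blast
  qed
qed

end
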